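(* Let $q$ be a prime power and let $C_m$ be a Hermitian code over $\mathbb{F}_{q^2}$ with $2q^2-2q-2\le m\le q^3+q^2-q-2$ (where $m$ is such that $\mathcal{B}$ contains a monomial of $w$-degree $m+1$), with distance $d=\mu q+\lambda(q+1)$, where $\mu,\lambda$ are the unique non-negative integers with this property and $\mu\le q$. Let $F\in\mathbb{F}_{q^2}[x,y]$ be a polynomial with $\mathrm{LM}_\prec(F)=x^\mu y^\lambda$. Then the curve defined by $F$ cuts on $\mathcal{H}$ a divisor $D$ (that is, $I_D=\langle H,F\rangle$) which is an $\mathbb{F}_{q^2}$-divisor equal to the support of a minimum-weight codeword of $C_m$ if and only if the ideal $\langle H,F\rangle$ contains the polynomials $x^{q^2}-x$ and $y^{q^2}-y$.
   Context: Let $q$ be a prime power. The Hermitian curve $\mathcal{H}$ is the curve in the affine plane over $\mathbb{F}_{q^2}$ defined by $H:=x^{q+1}-y^q-y$. It has exactly $n=q^3$ points $P_1,\dots,P_n$ with coordinates in $\mathbb{F}_{q^2}$; put $E=\{P_1,\dots,P_n\}$. The ideal of $E$ (as a reduced scheme) is $I_E=\langle H,\,x^{q^2}-x,\,y^{q^2}-y\rangle$ and $A_E=\mathbb{F}_{q^2}[x,y]/I_E$. An $\mathbb{F}_{q^2}$-divisor on $\mathcal{H}$ is a reduced zero-dimensional scheme consisting of pairwise distinct points of $E$ (identified with a subset of $E$). For a zero-dimensional subscheme $D$ of the affine plane, $I_D\subset\mathbb{F}_{q^2}[x,y]$ denotes its defining ideal; $D$ is cut on $\mathcal{H}$ by the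 curve defined by $F$ if it is the scheme-theoretic intersection, i.e. $I_D=\langle H,F\rangle$. $\prec$ denotes the term ordering DegRevLex on $\mathbb{F}_{q^2}[x,y]$ with $y>x$: $x^ry^s\prec x^{r'}y^{s'}$ iff $r+s<r'+s'$, or $r+s=r'+s'$ and $r>r'$. $\mathrm{LM}_\prec(F)$ is the leading monomial of $F$. The $w$-degree of a monomial is $w(x^ry^s)=rq+s(q+1)$. The set $\mathcal{B}=\{x^ry^s : 0\le r\le q,\ 0\le s\le q^2-q-1\}\cup\{y^s : q^2-q\le s\le q^2-1\}$ is a monomial basis of $A_E$. For an integer $m\le q^3+q^2-q-2$ put $\mathcal{B}_m=\{x^ry^s\in\mathcal{B} : rq+s(q+1)\le m\}$. The Hermitian code $C_m\subseteq(\mathbb{F}_{q^2})^n$ is the dual code of the span of the vectors $(f(P_1),\dots,f(P_n))$, $f\in\mathcal{B}_m$. Convention: a code is labelled by the integer $m$ only if $\mathcal{B}$ contains a monomial of $w$-degree $m+1$. For $m\ge 2q^2-2q-2$ the distance of $C_m$ is $d=m-q^2+q+2$. The support of a codeword $(c_1,\dots,c_n)$ is identified with the $\mathbb{F}_{q^2}$-divisor $\{P_i : c_i\ne0\}$. The distance of a code is the minimum weight of its non-zero codewords, and a minimum-weight codeword is a codeword whose weight equals the distance. *)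

theory Defs
  imports "HOL-Number_Theory.Prime_Powers" "HOL-Computational_Algebra.Polynomial"
begin

text \<open>
  The ring \<open>K[x,y]\<close> is represented as \<open>'a poly poly\<close>, i.e. as \<open>(K[x])[y]\<close>: the outer
  variable is \<open>y\<close>, the inner one is \<open>x\<close>.  The monomial \<open>x\<^sup>r y\<^sup>s\<close> is represented by its
  exponent pair \<open>(r, s)\<close>, and its coefficient in \<open>F\<close> is \<open>coeff (coeff F s) r\<close>.
\<close>

definition var_x :: "'a::comm_ring_1 poly poly" where
  "var_x = [:[:0, 1:]:]"

definition var_y :: "'a::comm_ring_1 poly poly" where
  "var_y = [:0, 1:]"

definition eval2 :: "'a::comm_ring_1 poly poly \<Rightarrow> 'a \<times> 'a \<Rightarrow> 'a" where
  "eval2 F = (\<lambda>(a, b). poly (poly F [:b:]) a)"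

text \<open>The ideal generated by \<open>S\<close> is the submodule of the ring spanned by \<open>S\<close>.\<close>

definition ideal_gen :: "'b::comm_ring_1 set \<Rightarrow> 'b set" where
  "ideal_gen S = module.span (*) S"

definition exponents :: "'a::comm_ring_1 poly poly \<Rightarrow> (nat \<times> nat) set" where
  "exponents F = {(r, s). coeff (coeff F s) r \<noteq> 0}"

definition drl_less :: "nat \<times> nat \<Rightarrow> nat \<times> nat \<Rightarrow> bool" where
  "drl_less = (\<lambda>(r, s) (r', s'). r + s < r' + s' \<or> (r + s = r' + s' \<and> r > r'))"

text \<open>The leading exponent pair with respect to DegRevLex with \<open>y > x\<close>; only meaningful for \<open>F \<noteq> 0\<close>.\<close>

definition lead_mon :: "'a::comm_ring_1 poly poly \<Rightarrow> nat \<times> nat" where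
  "lead_mon F = (THE t. t \<in> exponents F \<and> (\<forall>u \<in> exponents F. u \<noteq> t \<longrightarrow> drl_less u t))"

definition wdeg :: "nat \<Rightarrow> nat \<times> nat \<Rightarrow> nat" where
  "wdeg q = (\<lambda>(r, s). r * q + s * (q + 1))"

definition hermitian_poly :: "nat \<Rightarrow> 'a::comm_ring_1 poly poly" where
  "hermitian_poly q = var_x ^ (q + 1) - var_y ^ q - var_y"

definition hermitian_points :: "nat \<Rightarrow> ('a::comm_ring_1 \<times> 'a) set" where
  "hermitian_points q = {P. eval2 (hermitian_poly q) P = 0}"

text \<open>
  The defining ideal \<open>I\<^sub>D\<close> of a reduced zero-dimensional scheme \<open>D\<close> consisting of
  \<open>K\<close>-rational points, given as the set of these points.
\<close>

definition point_ideal :: "('a::comm_ring_1 \<times> 'a) set \<Rightarrow> 'a poly poly set" where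
  "point_ideal D = {G. \<forall>P \<in> D. eval2 G P = 0}"

definition rational_divisor :: "nat \<Rightarrow> ('a::comm_ring_1 \<times> 'a) set \<Rightarrow> bool" where
  "rational_divisor q D \<longleftrightarrow> D \<subseteq> hermitian_points q"

definition cuts_on_hermitian :: "nat \<Rightarrow> 'a::comm_ring_1 poly poly \<Rightarrow> ('a \<times> 'a) set \<Rightarrow> bool" where
  "cuts_on_hermitian q F D \<longleftrightarrow> point_ideal D = ideal_gen {hermitian_poly q, F}"

definition basis_monomials :: "nat \<Rightarrow> (nat \<times> nat) set" where
  "basis_monomials q =
     {(r, s). r \<le> q \<and> int s \<le> int q ^ 2 - int q - 1} \<union>
     {(0, s) | s. int q ^ 2 - int q \<le> int s \<and> int s \<le> int q ^ 2 - 1}"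

definition basis_monomials_upto :: "nat \<Rightarrow> int \<Rightarrow> (nat \<times> nat) set" where
  "basis_monomials_upto q m = {t \<in> basis_monomials q. int (wdeg q t) \<le> m}"

definition admissible_label :: "nat \<Rightarrow> int \<Rightarrow> bool" where
  "admissible_label q m \<longleftrightarrow> (\<exists>t \<in> basis_monomials q. int (wdeg q t) = m + 1)"

text \<open>
  Words of length \<open>n\<close> are indexed by the \<open>n\<close> points \<open>P\<^sub>1, \<dots>, P\<^sub>n\<close> of the curve themselves:
  a word is a function on the affine plane that vanishes off the curve.
\<close>

definition evaluation_word :: "nat \<Rightarrow> 'a::comm_ring_1 poly poly \<Rightarrow> 'a \<times> 'a \<Rightarrow> 'a" where
  "evaluation_word q f = (\<lambda>P. if P \<in> hermitian_points q then eval2 f P else 0)"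

text \<open>The linear span of the words \<open>(f(P\<^sub>1), \<dots>, f(P\<^sub>n))\<close> for \<open>f\<close> in \<open>\<B>\<^sub>m\<close>, which is a finite set.\<close>

definition evaluation_code :: "nat \<Rightarrow> int \<Rightarrow> ('a::comm_ring_1 \<times> 'a \<Rightarrow> 'a) set" where
  "evaluation_code q m =
     {(\<lambda>P. \<Sum>(r, s) \<in> basis_monomials_upto q m.
         a (r, s) * evaluation_word q (var_x ^ r * var_y ^ s) P) | a. True}"

definition dual_code ::
    "nat \<Rightarrow> ('a::comm_ring_1 \<times> 'a \<Rightarrow> 'a) set \<Rightarrow> ('a \<times> 'a \<Rightarrow> 'a) set" where
  "dual_code q V =
     {c. (\<forall>P. P \<notin> hermitian_points q \<longrightarrow> c P = 0) \<and>
         (\<forall>v \<in> V. (\<Sum>P \<in> hermitian_points q. c P * v P) = 0)}"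

definition hermitian_code :: "nat \<Rightarrow> int \<Rightarrow> ('a::comm_ring_1 \<times> 'a \<Rightarrow> 'a) set" where
  "hermitian_code q m = dual_code q (evaluation_code q m)"

definition word_support :: "('a::comm_ring_1 \<times> 'a \<Rightarrow> 'a) \<Rightarrow> ('a \<times> 'a) set" where
  "word_support c = {P. c P \<noteq> 0}"

definition word_weight :: "('a::comm_ring_1 \<times> 'a \<Rightarrow> 'a) \<Rightarrow> nat" where
  "word_weight c = card (word_support c)"

definition code_distance :: "('a::comm_ring_1 \<times> 'a \<Rightarrow> 'a) set \<Rightarrow> nat" where
  "code_distance C = Min (word_weight ` {c \<in> C. c \<noteq> (\<lambda>_. 0)})"

definition min_weight_codeword ::
    "('a::comm_ring_1 \<times> 'a \<Rightarrow> 'a) set \<Rightarrow> ('a \<times> 'a \<Rightarrow> 'a) \<Rightarrow> bool" where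
  "min_weight_codeword C c \<longleftrightarrow> c \<in> C \<and> word_weight c = code_distance C"

end

theory Submission
  imports Defs
begin

text \<open>
  Write \<open>E\<close> for the set of rational points of the curve \<open>H = x\<^sup>q\<^sup>+\<^sup>1 - y\<^sup>q - y\<close>, and \<open>w\<close> for the weight with
  \<open>w(x) = q\<close>, \<open>w(y) = q + 1\<close>, the pole order at the only point at infinity. The condition \<open>\<mu> \<le> q\<close>
  makes the DegRevLex-leading monomial of \<open>F\<close> also the only monomial of largest weight in \<open>F\<close>, and
  its weight is the distance \<open>d\<close>.

  One direction is immediate: every point of \<open>K\<^sup>2\<close> is a zero of both field equations, so an ideal of
  rational points contains them. For the other, let the ideal \<open>\<langle>H, F\<rangle>\<close> contain the field equations
  and let \<open>D\<close> be the set of common rational zeros of \<open>H\<close> and \<open>F\<close>.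

  \<^item> \<open>\<langle>H, F\<rangle>\<close> is the ideal of \<open>D\<close>. This is the Nullstellensatz over a finite field
    (\<open>finite_field_nullstellensatz\<close>), proved with the indicator polynomials of the points.

  \<^item> \<open>D\<close> has exactly \<open>d\<close> points. Let \<open>S\<close> be the semigroup generated by \<open>q\<close> and \<open>q + 1\<close>. Modulo \<open>H\<close> and
    \<open>F\<close> every polynomial is a combination of monomials with weights in the Apery set
    \<open>S \<setminus> (d + S)\<close>, one for each weight, and this set has \<open>d\<close> elements; hence \<open>|D| \<le> d\<close>
    (\<open>card_zeros_le\<close>). These monomials are moreover independent modulo \<open>\<langle>H, F\<rangle>\<close>, because pole
    orders add under multiplication (\<open>weight_of_combination\<close>); hence \<open>|D| \<ge> d\<close> (\<open>card_zeros_ge\<close>).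

  \<^item> \<open>D\<close> carries a nonzero codeword of \<open>C\<^sub>m\<close> (\<open>word_on_zeros\<close>). The largest element of the Apery set is
    \<open>d + q(q - 1) - 1\<close>. If it exceeds \<open>m\<close>, then a word on \<open>D\<close> has to satisfy at most \<open>d - 1\<close> linear
    conditions to be orthogonal to all monomials of weight at most \<open>m\<close>, and \<open>D\<close> provides \<open>d\<close> unknowns.

  \<^item> The largest element does exceed \<open>m\<close>: this is the Goppa bound \<open>d \<ge> m + 2 - q(q - 1)\<close>
    (\<open>goppa_bound\<close>), obtained here by the Feng-Rao argument (\<open>feng_rao_bound\<close>).

  The support of the codeword lies in \<open>D\<close>, and it has at least \<open>d = |D|\<close> points; so it equals \<open>D\<close>.

  The distance is the minimum of a set of weights, so the Goppa bound needs a nonzero codeword to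
  start from. The same count supplies it with \<open>x\<close>'s field equation in place of \<open>F\<close> and \<open>E\<close> in place
  of \<open>D\<close>.

  The coding arguments are carried out on syndromes. The sums \<open>\<Sum>\<^sub>P c\<^sub>P x(P)\<^sup>r y(P)\<^sup>s\<close>, as a
  two-dimensional array in \<open>(r, s)\<close>, satisfy a linear recurrence for each polynomial that vanishes on
  the support of \<open>c\<close>, and the array is filled in by induction on the weight.
\<close>

section \<open>The semigroup of weights\<close>

definition weights :: "nat \<Rightarrow> nat set" where
  "weights q = range (wdeg q)"

text \<open>
  On the curve \<open>y\<^sup>q\<close> can be replaced by \<open>x\<^sup>q\<^sup>+\<^sup>1 - y\<close>, so monomials with \<open>y\<close>-exponent below \<open>q\<close>
  suffice. Such a monomial is determined by its weight \<open>a = rq + s(q + 1) = (r + s)q + s\<close>, since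
  \<open>r + s\<close> and \<open>s\<close> are the quotient and the remainder of \<open>a\<close> by \<open>q\<close>. If \<open>a\<close> is not a weight, then the
  truncated subtraction makes the value meaningless.
\<close>
definition reduced_mon :: "nat \<Rightarrow> nat \<Rightarrow> nat \<times> nat" where
  "reduced_mon q a = (a div q - a mod q, a mod q)"

lemma wdeg_simp [simp]: "wdeg q (r, s) = r * q + s * (q + 1)"
  by (simp add: wdeg_def)

lemma wdeg_reduced_mon_if:
  assumes "a mod q \<le> a div q"
  shows "wdeg q (reduced_mon q a) = a"
proof -
  have "(a div q - a mod q) * q + a mod q * q = (a div q) * q"
    using assms by (simp flip: add_mult_distrib)
  moreover have "a div q * q + a mod q = a" by simp
  moreover have "wdeg q (reduced_mon q a) = (a div q - a mod q) * q + a mod q * q + a mod q"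
    by (simp add: reduced_mon_def)
  ultimately show ?thesis
    by metis
qed

lemma reduced_mon_wdeg: "s < q \<Longrightarrow> reduced_mon q (wdeg q (r, s)) = (r, s)"
proof -
  assume "s < q"
  moreover have "wdeg q (r, s) = s + (r + s) * q"
    by (simp add: algebra_simps)
  ultimately show ?thesis
    by (simp add: reduced_mon_def)
qed

lemma weights_iff:
  assumes "q > 0"
  shows "a \<in> weights q \<longleftrightarrow> a mod q \<le> a div q"
proof
  assume "a \<in> weights q"
  then obtain r s where a: "a = wdeg q (r, s)"
    by (auto simp: weights_def)
  have eq: "a = s + (r + s) * q"
    by (simp add: a algebra_simps)
  have "a mod q = s mod q" "a div q = r + s + s div q"
    using assms by (simp_all add: eq)
  then show "a mod q \<le> a div q"
    using mod_less_eq_dividend[of s q] by linarith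
next
  assume "a mod q \<le> a div q"
  then show "a \<in> weights q"
    unfolding weights_def by (metis rangeI wdeg_reduced_mon_if)
qed

lemma wdeg_reduced_mon: "q > 0 \<Longrightarrow> a \<in> weights q \<Longrightarrow> wdeg q (reduced_mon q a) = a"
  by (simp add: weights_iff wdeg_reduced_mon_if)

lemma wdeg_add: "wdeg q (r + i, s + j) = wdeg q (r, s) + wdeg q (i, j)"
  by (simp add: algebra_simps)

lemma wdeg_in_weights [simp]: "wdeg q t \<in> weights q"
  by (simp add: weights_def)

lemma weights_add: "a \<in> weights q \<Longrightarrow> b \<in> weights q \<Longrightarrow> a + b \<in> weights q"
  by (force simp: weights_def wdeg_add[symmetric] simp del: wdeg_simp)

lemma weights_mult: "a \<in> weights q \<Longrightarrow> k * a \<in> weights q"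
proof (induction k)
  case 0
  show ?case using wdeg_in_weights[of q "(0, 0)"] by simp
next
  case (Suc k)
  then show ?case using weights_add[of a q "k * a"] by simp
qed

lemma ge_conductor_in_weights:
  assumes "q > 0" "a \<ge> q * (q - 1)"
  shows "a \<in> weights q"
proof -
  have "q - 1 \<le> a div q"
    using assms by (simp add: less_eq_div_iff_mult_less_eq mult.commute)
  moreover have "a mod q \<le> q - 1"
    using mod_less_divisor[OF assms(1), of a] by linarith
  ultimately show ?thesis
    unfolding weights_iff[OF assms(1)] by (rule order_trans[rotated])
qed

lemma largest_gap:
  assumes "q \<ge> 2"
  shows "q * (q - 1) - 1 \<notin> weights q"
proof -
  obtain k where q: "q = Suc (Suc k)"
    using assms by (metis add_2_eq_Suc le_Suc_ex)
  have eq: "q * (q - 1) - 1 = (q - 1) + k * q"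
    by (simp add: q algebra_simps)
  have "((q - 1) + k * q) mod q = q - 1" "((q - 1) + k * q) div q = k"
    using assms by (simp_all only: mod_mult_self1 div_mult_self1, simp_all)
  then show ?thesis
    using assms by (simp add: weights_iff eq q)
qed

text \<open>
  A gap is determined by its quotient and its remainder modulo \<open>q\<close>, and the remainder is the larger of
  the two. There are \<open>q(q - 1)/2\<close> such pairs; this number is the genus of the curve.
\<close>
lemma card_gaps:
  assumes "q > 0"
  shows "finite (- weights q)" "2 * card (- weights q) \<le> q * (q - 1)"
proof -
  define T where "T = (SIGMA j:{..<q}. {..<j})"
  have inj: "inj_on (\<lambda>a. (a mod q, a div q)) (- weights q)"
    by (rule inj_onI) (metis div_mult_mod_eq prod.inject)
  have sub: "(\<lambda>a. (a mod q, a div q)) ` (- weights q) \<subseteq> T"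
    using assms by (auto simp: T_def weights_iff)
  have fin: "finite T" by (simp add: T_def)
  show "finite (- weights q)"
    by (rule inj_on_finite[OF inj sub fin])
  have "card (- weights q) \<le> card T"
    by (rule card_inj_on_le[OF inj sub fin])
  also have "card T = (\<Sum>j<q. j)"
    by (simp add: T_def)
  also have "2 * \<dots> = q * (q - 1)"
    by (induction q) (auto simp: algebra_simps)
  finally show "2 * card (- weights q) \<le> q * (q - 1)" by simp
qed

definition apery :: "nat \<Rightarrow> nat \<Rightarrow> nat set" where
  "apery q d = {a \<in> weights q. \<forall>b \<in> weights q. a \<noteq> d + b}"

text \<open>
  The least weight in a residue class modulo \<open>d\<close> is in the Apery set, and any other weight in the class
  exceeds it by a multiple of \<open>d\<close>, hence is \<open>d\<close> plus a weight.
\<close>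
lemma
  assumes "q > 0" "d > 0" "d \<in> weights q"
  shows finite_apery: "finite (apery q d)" and card_apery: "card (apery q d) = d"
proof -
  have inj: "inj_on (\<lambda>a. a mod d) (apery q d)"
  proof (rule inj_onI)
    have *: "a = b" if ab: "a \<in> apery q d" "b \<in> apery q d" "a mod d = b mod d" "a \<le> b" for a b
    proof (rule ccontr)
      assume "a \<noteq> b"
      with that have "a < b" by simp
      obtain k where k: "b = a + d * k"
        by (rule mod_eq_nat2E[OF ab(3,4)])
      with \<open>a < b\<close> obtain j where "k = Suc j" by (cases k) auto
      then have "b = d + (a + j * d)" by (simp add: k algebra_simps)
      moreover have "a + j * d \<in> weights q"
        using that assms by (intro weights_add weights_mult) (auto simp: apery_def)
      ultimately show False using that by (auto simp: apery_def)
    qed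
    fix a b assume "a \<in> apery q d" "b \<in> apery q d" "a mod d = b mod d"
    then show "a = b" using * by (metis nat_le_linear)
  qed
  have img: "(\<lambda>a. a mod d) ` apery q d = {..<d}"
  proof (intro equalityI subsetI)
    fix i assume "i \<in> {..<d}"
    then have i: "i < d" by simp
    define P where "P a \<longleftrightarrow> a \<in> weights q \<and> a mod d = i" for a
    \<comment> \<open>Any element of the class beyond the conductor \<open>q(q - 1)\<close> is a weight.\<close>
    have "P (i + (q * (q - 1)) * d)"
      using assms i unfolding P_def by (auto intro!: ge_conductor_in_weights simp: trans_le_add2)
    then have P: "P (LEAST a. P a)" and least: "\<And>b. P b \<Longrightarrow> (LEAST a. P a) \<le> b"
      by (auto intro: LeastI Least_le)
    have "(LEAST a. P a) \<in> apery q d"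
      unfolding apery_def
    proof (intro CollectI conjI ballI notI)
      fix b assume b: "b \<in> weights q" "(LEAST a. P a) = d + b"
      then have "P b" using P by (simp add: P_def)
      from least[OF this] b assms show False by simp
    qed (use P in \<open>simp add: P_def\<close>)
    moreover have "(LEAST a. P a) mod d = i" using P by (simp add: P_def)
    ultimately show "i \<in> (\<lambda>a. a mod d) ` apery q d" by blast
  qed (use assms in auto)
  show "finite (apery q d)"
    using inj img by (metis finite_imageD finite_lessThan)
  show "card (apery q d) = d"
    using card_image[OF inj] img by simp
qed

lemma largest_in_apery:
  assumes "q \<ge> 2" "d > 0"
  shows "d + (q * (q - 1) - 1) \<in> apery q d"
proof -
  have "q * (q - 1) > 0" using assms by simp
  then have "d + (q * (q - 1) - 1) \<in> weights q"
    using assms by (intro ge_conductor_in_weights) auto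
  with largest_gap[OF assms(1)] show ?thesis
    by (auto simp: apery_def)
qed

section \<open>Homogeneous linear systems over a finite field\<close>

text \<open>
  Over a finite field the existence of a nontrivial solution is a pigeonhole argument: two different
  assignments of values to the unknowns have the same image, and their difference is a solution.
\<close>
lemma nontrivial_solution:
  fixes f :: "'i \<Rightarrow> 'j \<Rightarrow> 'a::{field, finite}"
  assumes "finite I" "finite J" "card J < card I"
  obtains \<alpha> where "\<exists>i\<in>I. \<alpha> i \<noteq> 0" "\<And>i. i \<notin> I \<Longrightarrow> \<alpha> i = 0" "\<And>j. j \<in> J \<Longrightarrow> (\<Sum>i\<in>I. \<alpha> i * f i j) = 0"
proof -
  let ?K = "UNIV :: 'a set"
  define h where "h \<alpha> = (\<lambda>j\<in>J. \<Sum>i\<in>I. \<alpha> i * f i j)" for \<alpha>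
  have "1 < card ?K"
    using card_mono[of ?K "{0, 1}"] by simp
  then have "card (J \<rightarrow>\<^sub>E ?K) < card (I \<rightarrow>\<^sub>E ?K)"
    using assms by (simp add: card_PiE power_strict_increasing)
  moreover have "h ` (I \<rightarrow>\<^sub>E ?K) \<subseteq> J \<rightarrow>\<^sub>E ?K" "finite (J \<rightarrow>\<^sub>E ?K)"
    using assms by (auto simp: h_def intro!: finite_PiE)
  ultimately have "\<not> inj_on h (I \<rightarrow>\<^sub>E ?K)"
    using card_inj_on_le leD by blast
  then obtain u v where uv: "u \<in> I \<rightarrow>\<^sub>E ?K" "v \<in> I \<rightarrow>\<^sub>E ?K" "h u = h v" "u \<noteq> v"
    by (auto simp: inj_on_def)
  \<comment> \<open>Outside \<open>I\<close> the assignments agree; the conditional makes their difference zero there.\<close>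
  obtain i where "u i \<noteq> v i" using uv(4) by blast
  moreover from this have "i \<in> I" using uv by (metis PiE_arb)
  moreover have "(\<Sum>i\<in>I. (if i \<in> I then u i - v i else 0) * f i j) = 0" if "j \<in> J" for j
  proof -
    have "h u j = h v j" using uv by simp
    with that show ?thesis by (simp add: h_def left_diff_distrib sum_subtractf)
  qed
  ultimately show thesis
    by (intro that[of "\<lambda>i. if i \<in> I then u i - v i else 0"]) auto
qed

section \<open>Arrays with a linear recurrence\<close>

text \<open>
  The recurrence that the curve equation \<open>x\<^sup>q\<^sup>+\<^sup>1 = y\<^sup>q + y\<close> imposes on the array of syndromes of a word.
  The terms at \<open>x\<^sup>q\<^sup>+\<^sup>1\<close> and \<open>y\<^sup>q\<close> have the same weight, the one at \<open>y\<close> is lighter.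
\<close>
definition curve_array :: "nat \<Rightarrow> (nat \<times> nat \<Rightarrow> 'a::comm_ring_1) \<Rightarrow> bool" where
  "curve_array q S \<longleftrightarrow> (\<forall>r s. S (r + (q + 1), s) = S (r, s + q) + S (r, s + 1))"

text \<open>
  Once the array is zero below weight \<open>N\<close>, the lightest term of the recurrence drops out at weight
  \<open>N\<close>. What is left moves \<open>y\<^sup>q\<close> to \<open>x\<^sup>q\<^sup>+\<^sup>1\<close> without changing the entry, until the monomial is reduced.
\<close>
lemma array_value_by_weight:
  fixes S :: "nat \<times> nat \<Rightarrow> 'a::comm_ring_1"
  assumes "q \<ge> 2" "curve_array q S"
    and low: "\<And>t. wdeg q t < N \<Longrightarrow> S t = 0"
    and "wdeg q t = N"
  shows "S t = S (reduced_mon q N)"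
proof -
  have "S (r, s) = S (reduced_mon q N)" if "wdeg q (r, s) = N" for r s
    using that
  proof (induction s arbitrary: r rule: less_induct)
    case (less s)
    show ?case
    proof (cases "s < q")
      case True
      then show ?thesis using reduced_mon_wdeg[of s q r] less.prems by simp
    next
      case False
      then obtain j where s: "s = j + q" by (metis add.commute le_iff_add not_less)
      have "S (r, j + q) = S (r + (q + 1), j) - S (r, j + 1)"
        using assms(2) by (simp add: curve_array_def)
      also have "S (r, j + 1) = 0"
      proof (rule low)
        have "1 * (q + 1) < q * (q + 1)" using assms(1) by (intro mult_strict_right_mono) auto
        then show "wdeg q (r, j + 1) < N"
          using less.prems by (simp add: s algebra_simps)
      qed
      also have "S (r + (q + 1), j) = S (reduced_mon q N)"
        by (rule less.IH) (use less.prems assms(1) in \<open>auto simp: s algebra_simps\<close>)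
      finally show ?thesis by (simp add: s)
    qed
  qed
  then show ?thesis using assms(4) by (cases t) auto
qed

text \<open>
  By the preceding lemma an induction on the weight has to treat one monomial of each weight only, and
  is free to choose it.
\<close>
lemma array_vanishes_below:
  fixes S :: "nat \<times> nat \<Rightarrow> 'a::comm_ring_1"
  assumes "q \<ge> 2" "curve_array q S"
    and step: "\<And>N. N \<in> weights q \<Longrightarrow> N < M \<Longrightarrow> (\<And>t. wdeg q t < N \<Longrightarrow> S t = 0) \<Longrightarrow>
       \<exists>t. wdeg q t = N \<and> S t = 0"
  shows "wdeg q t < M \<Longrightarrow> S t = 0"
proof (induction "wdeg q t" arbitrary: t rule: less_induct)
  case less
  have low: "S u = 0" if "wdeg q u < wdeg q t" for u
    using less that by simp
  obtain u where "wdeg q u = wdeg q t" "S u = 0"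
    using step[OF wdeg_in_weights less.prems] low by blast
  with array_value_by_weight[OF assms(1,2) low] show ?case
    by metis
qed

text \<open>
  The basis \<open>\<B>\<close> is as good as all monomials. Let \<open>Q = q\<^sup>2\<close>. A monomial with \<open>x\<close>-exponent at most \<open>q\<close>
  that is not in \<open>\<B>\<close> is a multiple of \<open>y\<^sup>Q\<close>, or of \<open>x y\<^bsup>Q - q\<^esup>\<close>. The field equation for \<open>y\<close> lowers the
  weight in the first case. In the second, \<open>y\<^bsup>Q - q\<^esup>\<close> may be replaced by \<open>x\<^bsup>Q - 1\<^esup>\<close>, which has the same
  weight \<open>q(Q - 1)\<close>, and the field equation for \<open>x\<close> applies to the resulting \<open>x\<^sup>Q\<close>.
\<close>
lemma array_vanishes_from_basis:
  fixes S :: "nat \<times> nat \<Rightarrow> 'a::comm_ring_1"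
  assumes q: "q \<ge> 2" and curve: "curve_array q S"
    and fx: "\<And>r s. S (r + q ^ 2, s) = S (r + 1, s)"
    and fy: "\<And>r s. S (r, s + q ^ 2) = S (r, s + 1)"
    and basis: "\<And>t. t \<in> basis_monomials q \<Longrightarrow> wdeg q t < M \<Longrightarrow> S t = 0"
    and "wdeg q t < M"
  shows "S t = 0"
  using q curve _ \<open>wdeg q t < M\<close>
proof (rule array_vanishes_below)
  fix N assume "N \<in> weights q" "N < M" and low: "\<And>t. wdeg q t < N \<Longrightarrow> S t = 0"
  from \<open>N \<in> weights q\<close> obtain r0 s0 where "N = wdeg q (r0, s0)" by (auto simp: weights_def)
  \<comment> \<open>Trading \<open>x\<^sup>q\<^sup>+\<^sup>1\<close> for \<open>y\<^sup>q\<close> keeps the weight and brings the exponent of \<open>x\<close> down to at most \<open>q\<close>.\<close>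
  define r s where "r = r0 mod (q + 1)" and "s = s0 + q * (r0 div (q + 1))"
  have "r0 = r + (q + 1) * (r0 div (q + 1))" unfolding r_def by (rule mod_mult_div_eq[symmetric])
  then have "r0 * q + s0 * (q + 1) = (r + (q + 1) * (r0 div (q + 1))) * q + s0 * (q + 1)" by presburger
  then have N: "wdeg q (r, s) = N"
    by (simp add: \<open>N = _\<close> s_def algebra_simps)
  have "r \<le> q" unfolding r_def using mod_less_divisor[of "q + 1" r0] by simp
  have qq: "q < q ^ 2" using q by (simp add: power2_eq_square)
  show "\<exists>t. wdeg q t = N \<and> S t = 0"
  proof (cases "(r, s) \<in> basis_monomials q")
    case True
    then show ?thesis using basis N \<open>N < M\<close> by blast
  next
    case False
    show ?thesis
    proof (cases "r = 0")
      case True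
      have "\<not> (q ^ 2 - q \<le> s \<and> s < q ^ 2)" "\<not> s < q ^ 2 - q"
        using False True qq by (auto simp: basis_monomials_def of_nat_diff zle_diff1_eq less_diff_conv2 simp flip: of_nat_power)
      then have "q ^ 2 \<le> s" by linarith
      then obtain j where s: "s = j + q ^ 2" by (metis le_add_diff_inverse2)
      have "S (r, s) = S (r, j + 1)" by (simp add: s fy)
      also have "\<dots> = 0"
      proof (rule low)
        have "1 * (q + 1) < q ^ 2 * (q + 1)"
          by (rule mult_strict_right_mono) (use q qq in auto)
        then show "wdeg q (r, j + 1) < N"
          using N by (simp add: s algebra_simps)
      qed
      finally show ?thesis using N by blast
    next
      case r: False
      have "\<not> s < q ^ 2 - q"
        using False \<open>r \<le> q\<close> qq by (auto simp: basis_monomials_def simp flip: of_nat_power)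
      then obtain j where s: "s = j + (q ^ 2 - q)" by (metis le_add_diff_inverse2 not_less)
      obtain i where i: "r = Suc i" using r by (cases r) auto
      have eq: "q * q ^ 2 + (q + 1) * q = q + (q + 1) * q ^ 2"
        by (simp add: algebra_simps power2_eq_square)
      have "(q ^ 2 - q) * (q + 1) + q * (q + 1) = q ^ 2 * (q + 1)"
        using qq by (simp flip: add_mult_distrib)
      then have eq': "(q ^ 2 - q) * (q + 1) + q = q * q ^ 2"
        using eq by (simp add: algebra_simps)
      have "wdeg q (i + q ^ 2, j) = N"
        using N eq' by (simp add: s i algebra_simps)
      moreover have "S (i + q ^ 2, j) = 0"
      proof -
        have "S (i + q ^ 2, j) = S (i + 1, j)" by (rule fx)
        also have "\<dots> = 0"
        proof (rule low)
          have "0 < (q ^ 2 - q) * (q + 1)" using qq by simp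
          moreover have "N = wdeg q (i + 1, j) + (q ^ 2 - q) * (q + 1)"
            unfolding N[symmetric] s i wdeg_simp Suc_eq_plus1 add_mult_distrib by (simp only: add_ac)
          ultimately show "wdeg q (i + 1, j) < N" by linarith
        qed
        finally show ?thesis .
      qed
      ultimately show ?thesis by blast
    qed
  qed
qed

text \<open>
  A linear recurrence whose heaviest term is \<open>u\<close> determines every entry whose weight is the weight of
  \<open>u\<close> plus a weight; only the entries at weights in the Apery set are free.
\<close>
lemma array_vanishes_from_apery:
  fixes S :: "nat \<times> nat \<Rightarrow> 'a::field"
  assumes q: "q \<ge> 2" and curve: "curve_array q S"
    and rel: "\<And>r s. (\<Sum>(i, j)\<in>T. a (i, j) * S (r + i, s + j)) = 0"
    and "finite T" "u \<in> T" "a u \<noteq> 0"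
    and heaviest: "\<And>v. v \<in> T \<Longrightarrow> v \<noteq> u \<Longrightarrow> wdeg q v < wdeg q u"
    and init: "\<And>N. N \<in> apery q (wdeg q u) \<Longrightarrow> N < M \<Longrightarrow> S (reduced_mon q N) = 0"
    and "wdeg q t < M"
  shows "S t = 0"
  using q curve _ \<open>wdeg q t < M\<close>
proof (rule array_vanishes_below)
  fix N assume N: "N \<in> weights q" "N < M" and low: "\<And>t. wdeg q t < N \<Longrightarrow> S t = 0"
  show "\<exists>t. wdeg q t = N \<and> S t = 0"
  proof (cases "N \<in> apery q (wdeg q u)")
    case True
    then have "S (reduced_mon q N) = 0" using init N by blast
    moreover have "wdeg q (reduced_mon q N) = N" using wdeg_reduced_mon[of q N] N q by simp
    ultimately show ?thesis by blast
  next
    case False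
    then obtain r s where rs: "N = wdeg q u + wdeg q (r, s)"
      using N by (auto simp: apery_def weights_def simp del: wdeg_simp)
    obtain i0 j0 where u: "u = (i0, j0)" by (cases u)
    have "(\<Sum>(i, j)\<in>T - {u}. a (i, j) * S (r + i, s + j)) = 0"
    proof (intro sum.neutral ballI)
      fix v assume "v \<in> T - {u}"
      moreover obtain i j where v: "v = (i, j)" by (cases v)
      ultimately have "S (r + i, s + j) = 0"
        using heaviest[of v] by (intro low) (simp add: rs wdeg_add del: wdeg_simp)
      then show "(case v of (i, j) \<Rightarrow> a (i, j) * S (r + i, s + j)) = 0" by (simp add: v)
    qed
    then have "a u * S (r + i0, s + j0) = 0"
      using rel[of r s] assms(4,5) by (simp add: sum.remove u)
    moreover have "wdeg q (r + i0, s + j0) = N"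
      by (simp add: rs u wdeg_add del: wdeg_simp)
    ultimately show ?thesis using assms(6) by auto
  qed
qed

section \<open>Evaluation and syndromes\<close>

lemma eval2_add: "eval2 (F + G) P = eval2 F P + eval2 G P"
  and eval2_diff: "eval2 (F - G) P = eval2 F P - eval2 G P"
  and eval2_mult: "eval2 (F * G) P = eval2 F P * eval2 G P"
  and eval2_0: "eval2 0 P = 0"
  and eval2_1: "eval2 1 P = 1"
  by (simp_all add: eval2_def split: prod.split)

lemma eval2_sum: "eval2 (\<Sum>i\<in>I. F i) P = (\<Sum>i\<in>I. eval2 (F i) P)"
  by (induction I rule: infinite_finite_induct) (simp_all add: eval2_0 eval2_add)

lemma eval2_prod: "eval2 (\<Prod>i\<in>I. F i) P = (\<Prod>i\<in>I. eval2 (F i) P)"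
  by (induction I rule: infinite_finite_induct) (simp_all add: eval2_1 eval2_mult)

lemma eval2_power: "eval2 (F ^ n) P = eval2 F P ^ n"
  by (induction n) (simp_all add: eval2_1 eval2_mult)

lemma eval2_var_x: "eval2 var_x P = fst P"
  and eval2_var_y: "eval2 var_y P = snd P"
  and eval2_const: "eval2 [:[:a:]:] P = a"
  by (simp_all add: eval2_def var_x_def var_y_def split: prod.split)

lemmas eval2_simps = eval2_add eval2_diff eval2_mult eval2_0 eval2_1 eval2_sum eval2_prod
  eval2_power eval2_var_x eval2_var_y eval2_const

lemma mem_hermitian_points:
  "P \<in> hermitian_points q \<longleftrightarrow> fst P ^ (q + 1) = snd P ^ q + snd P"
  by (simp add: hermitian_points_def hermitian_poly_def eval2_simps algebra_simps)

lemma finite_exponents [simp]: "finite (exponents F)"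
proof (rule finite_subset)
  show "exponents F \<subseteq> (\<Union>s\<le>degree F. {..degree (coeff F s)} \<times> {s})"
  proof (intro subsetI)
    fix t assume "t \<in> exponents F"
    then obtain r s where t: "t = (r, s)" "coeff (coeff F s) r \<noteq> 0" by (auto simp: exponents_def)
    then have "coeff F s \<noteq> 0" by auto
    with t show "t \<in> (\<Union>s\<le>degree F. {..degree (coeff F s)} \<times> {s})"
      by (auto simp: le_degree)
  qed
qed simp

lemma poly2_expansion:
  "F = (\<Sum>(r, s)\<in>exponents F. monom (monom (coeff (coeff F s) r) r) s)"
proof (intro poly_eqI)
  fix s r
  have "coeff (coeff (\<Sum>(i, j)\<in>exponents F. monom (monom (coeff (coeff F j) i) i) j) s) r =
    (\<Sum>t\<in>exponents F. if t = (r, s) then coeff (coeff F s) r else 0)"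
    unfolding coeff_sum by (intro sum.cong) (auto split: if_splits)
  also have "\<dots> = coeff (coeff F s) r"
    by (simp add: sum.delta) (simp add: exponents_def)
  finally show "coeff (coeff F s) r =
    coeff (coeff (\<Sum>(i, j)\<in>exponents F. monom (monom (coeff (coeff F j) i) i) j) s) r" ..
qed

lemma eval2_monom: "eval2 (monom (monom a r) s) P = a * (fst P ^ r * snd P ^ s)"
  by (simp add: eval2_def poly_monom mult_ac split: prod.split)

lemma eval2_expansion:
  "eval2 F P = (\<Sum>(r, s)\<in>exponents F. coeff (coeff F s) r * (fst P ^ r * snd P ^ s))"
  by (subst poly2_expansion) (simp add: eval2_sum eval2_monom split_beta)

text \<open>Multiplication by a nonzero element permutes the nonzero elements, so it preserves their product.\<close>
lemma finite_field_power_card: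
  fixes x :: "'a::{field, finite}"
  shows "x ^ card (UNIV :: 'a set) = x"
proof (cases "x = 0")
  case False
  have pos: "card (UNIV :: 'a set) > 0" by (simp add: finite_UNIV_card_ge_0)
  have "(\<Prod>y\<in>UNIV-{0}. y) = (\<Prod>y\<in>UNIV-{0}. x * y)"
    by (rule prod.reindex_bij_witness[of _ "\<lambda>y. x * y" "\<lambda>y. y / x"]) (use False in auto)
  also have "\<dots> = x ^ (card (UNIV :: 'a set) - 1) * (\<Prod>y\<in>UNIV-{0}. y)"
    by (simp add: prod.distrib)
  finally have "x ^ (card (UNIV :: 'a set) - 1) = 1" by simp
  then show ?thesis using pos by (metis Suc_diff_1 mult.right_neutral power_Suc)
qed (simp add: finite_UNIV_card_ge_0)

definition syndrome :: "('a::{field, finite} \<times> 'a \<Rightarrow> 'a) \<Rightarrow> nat \<times> nat \<Rightarrow> 'a" where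
  "syndrome c = (\<lambda>(r, s). \<Sum>P\<in>UNIV. c P * (fst P ^ r * snd P ^ s))"

lemma sum_eval2_eq_syndromes:
  "(\<Sum>P\<in>UNIV. c P * eval2 F P) = (\<Sum>(r, s)\<in>exponents F. coeff (coeff F s) r * syndrome c (r, s))"
  by (simp add: eval2_expansion syndrome_def sum_distrib_left sum.swap[of _ "exponents F"] split_beta mult_ac)

lemma syndrome_relation:
  "(\<Sum>(i, j)\<in>exponents F. coeff (coeff F j) i * syndrome c (r + i, s + j)) =
     (\<Sum>P\<in>UNIV. c P * (fst P ^ r * snd P ^ s) * eval2 F P)"
  by (simp add: eval2_expansion syndrome_def sum_distrib_left sum.swap[of _ "exponents F"]
      split_beta mult_ac power_add)

text \<open>
  Only \<open>P\<close> is a nonzero of this polynomial. The value at \<open>P\<close> is not normalised to \<open>1\<close>.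
\<close>
definition indicator_poly :: "'a::{field, finite} \<times> 'a \<Rightarrow> 'a poly poly" where
  "indicator_poly P =
     (\<Prod>a\<in>UNIV - {fst P}. var_x - [:[:a:]:]) * (\<Prod>b\<in>UNIV - {snd P}. var_y - [:[:b:]:])"

lemma eval2_indicator_poly: "eval2 (indicator_poly P) Q = 0 \<longleftrightarrow> Q \<noteq> P"
  by (auto simp: indicator_poly_def eval2_simps prod_eq_iff)

text \<open>
  If all syndromes are zero, then the word is orthogonal to every polynomial, in particular to the
  indicator polynomials.
\<close>
lemma syndromes_determine_word:
  assumes "\<And>t. syndrome c t = 0"
  shows "c P = 0"
proof -
  have "c P * eval2 (indicator_poly P) P = (\<Sum>Q\<in>UNIV. c Q * eval2 (indicator_poly P) Q)"
    by (subst sum.mono_neutral_right[of UNIV "{P}"]) (auto simp: eval2_indicator_poly)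
  also have "\<dots> = 0"
    by (simp add: sum_eval2_eq_syndromes assms split_beta)
  finally show ?thesis
    using eval2_indicator_poly[of P P] by simp
qed

lemma curve_array_syndrome:
  fixes c :: "'a::{field, finite} \<times> 'a \<Rightarrow> 'a"
  assumes "word_support c \<subseteq> hermitian_points q"
  shows "curve_array q (syndrome c)"
  unfolding curve_array_def
proof (intro allI)
  fix r s
  have *: "c P * (fst P ^ (r + (q + 1)) * snd P ^ s) =
    c P * (fst P ^ r * snd P ^ (s + q)) + c P * (fst P ^ r * snd P ^ (s + 1))" for P
  proof (cases "c P = 0")
    case False
    then have "fst P ^ (q + 1) = snd P ^ q + snd P"
      using assms unfolding mem_hermitian_points[symmetric] word_support_def by blast
    then show ?thesis
      unfolding power_add[of _ r] power_add[of _ s] by (simp add: algebra_simps)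
  qed simp
  show "syndrome c (r + (q + 1), s) = syndrome c (r, s + q) + syndrome c (r, s + 1)"
    unfolding syndrome_def by (simp only: prod.case * sum.distrib)
qed

text \<open>
  The dual of a span is given by the orthogonality to the spanning monomials; a single coefficient
  equal to \<open>1\<close> isolates each of them.
\<close>
lemma mem_hermitian_code:
  fixes c :: "'a::{field, finite} \<times> 'a \<Rightarrow> 'a"
  shows "c \<in> hermitian_code q m \<longleftrightarrow> word_support c \<subseteq> hermitian_points q \<and>
    (\<forall>t\<in>basis_monomials_upto q m. syndrome c t = 0)"
proof (cases "word_support c \<subseteq> hermitian_points q")
  case True
  let ?B = "basis_monomials_upto q m"
  have fin: "finite ?B"
  proof (rule finite_subset)
    show "?B \<subseteq> {..q} \<times> {..q ^ 2}"
      by (auto simp: basis_monomials_upto_def basis_monomials_def simp flip: of_nat_power)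
  qed simp
  have E: "(\<Sum>P\<in>hermitian_points q. c P * g P) = (\<Sum>P\<in>UNIV. c P * g P)" for g
    using True by (intro sum.mono_neutral_left) (auto simp: word_support_def)
  have dual: "(\<Sum>P\<in>hermitian_points q. c P * (\<Sum>(r, s)\<in>?B. a (r, s) *
      evaluation_word q (var_x ^ r * var_y ^ s) P)) = (\<Sum>t\<in>?B. a t * syndrome c t)" for a
  proof -
    have "(\<Sum>P\<in>hermitian_points q. c P * (\<Sum>(r, s)\<in>?B. a (r, s) *
        evaluation_word q (var_x ^ r * var_y ^ s) P)) =
      (\<Sum>P\<in>hermitian_points q. c P * (\<Sum>(r, s)\<in>?B. a (r, s) * (fst P ^ r * snd P ^ s)))"
      by (intro sum.cong) (auto simp: evaluation_word_def eval2_simps)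
    also have "\<dots> = (\<Sum>t\<in>?B. a t * syndrome c t)"
      unfolding E by (simp add: syndrome_def sum_distrib_left sum.swap[of _ ?B] split_beta mult_ac)
    finally show ?thesis .
  qed
  have "c \<in> hermitian_code q m \<longleftrightarrow> (\<forall>a. (\<Sum>t\<in>?B. a t * syndrome c t) = 0)"
    using True by (auto simp: hermitian_code_def dual_code_def evaluation_code_def dual word_support_def)
  also have "\<dots> \<longleftrightarrow> (\<forall>t\<in>?B. syndrome c t = 0)"
  proof safe
    fix r s assume *: "\<forall>a. (\<Sum>t\<in>?B. a t * syndrome c t) = 0" "(r, s) \<in> ?B"
    from *(1)[rule_format, of "\<lambda>t. if t = (r, s) then 1 else 0"] *(2) fin
    show "syndrome c (r, s) = 0"
      by (simp add: if_distrib[of "\<lambda>x. x * _"] cong: if_cong)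
  qed (simp add: sum.neutral)
  finally show ?thesis using True by simp
qed (auto simp: hermitian_code_def dual_code_def word_support_def)

lemma hermitian_code_syndromes:
  fixes c :: "'a::{field, finite} \<times> 'a \<Rightarrow> 'a"
  assumes "q \<ge> 2" "card (UNIV :: 'a set) = q ^ 2" "c \<in> hermitian_code q m" "int (wdeg q t) \<le> m"
  shows "syndrome c t = 0"
proof (rule array_vanishes_from_basis[where M = "nat (m + 1)"])
  have xq: "x ^ (q ^ 2) = x" for x :: 'a
    using finite_field_power_card[of x] assms(2) by simp
  show "syndrome c (r + q ^ 2, s) = syndrome c (r + 1, s)"
    and "syndrome c (r, s + q ^ 2) = syndrome c (r, s + 1)" for r s
    by (simp_all add: syndrome_def power_add xq mult_ac)
  show "curve_array q (syndrome c)"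
    using assms(3) by (intro curve_array_syndrome) (simp add: mem_hermitian_code)
  show "syndrome c t = 0" if "t \<in> basis_monomials q" "wdeg q t < nat (m + 1)" for t
    using that assms(3) by (cases t) (auto simp: mem_hermitian_code basis_monomials_upto_def simp del: wdeg_simp)
qed (use assms in auto)

section \<open>The Feng-Rao bound\<close>

text \<open>
  Let \<open>N\<close> be the least weight of a nonzero syndrome. For the weights \<open>a\<close> such that \<open>N - a\<close> is a
  weight, the reduced monomials of weight \<open>a\<close> are independent as functions on the support: given a
  relation, multiply it by the monomial of weight \<open>N - a\<^sub>0\<close>, where \<open>a\<^sub>0\<close> is the largest weight that
  occurs, and sum it against \<open>c\<close>. The terms with \<open>a < a\<^sub>0\<close> become syndromes below \<open>N\<close> and vanish,
  while the remaining term is a nonzero syndrome of weight \<open>N\<close>. So the support has at least as many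
  points as there are such \<open>a\<close>, and among the \<open>N + 1\<close> numbers up to \<open>N\<close> only those are excluded for
  which \<open>a\<close> or \<open>N - a\<close> is a gap.
\<close>
lemma feng_rao_bound:
  fixes c :: "'a::{field, finite} \<times> 'a \<Rightarrow> 'a"
  assumes q: "q \<ge> 2" and E: "word_support c \<subseteq> hermitian_points q" and "c \<noteq> (\<lambda>_. 0)"
    and zero: "\<And>t. wdeg q t < M \<Longrightarrow> syndrome c t = 0"
  shows "M + 1 \<le> word_weight c + q * (q - 1)"
proof -
  define Q where "Q n \<longleftrightarrow> (\<exists>t. wdeg q t = n \<and> syndrome c t \<noteq> 0)" for n
  define N where "N = (LEAST n. Q n)"
  obtain t0 where "syndrome c t0 \<noteq> 0"
    using syndromes_determine_word[of c] assms(3) by blast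
  then have "Q (wdeg q t0)" unfolding Q_def by blast
  then have "Q N" unfolding N_def by (rule LeastI)
  then obtain t where t: "wdeg q t = N" "syndrome c t \<noteq> 0" unfolding Q_def by blast
  have low: "syndrome c u = 0" if "wdeg q u < N" for u
    using not_less_Least[of "wdeg q u" Q] that unfolding N_def Q_def by blast
  have top: "syndrome c u \<noteq> 0" if "wdeg q u = N" for u
    using array_value_by_weight[OF q curve_array_syndrome[OF E] low] t that by metis
  have "M \<le> N" using zero t by (meson not_less)
  define I where "I = {a \<in> {..N}. a \<in> weights q \<and> N - a \<in> weights q}"
  have "card I \<le> card (word_support c)"
  proof (rule ccontr)
    assume "\<not> ?thesis"
    then have less: "card (word_support c) < card I" by simp
    have fin: "finite I" by (simp add: I_def)
    obtain \<alpha> where \<alpha>: "\<exists>a\<in>I. \<alpha> a \<noteq> 0" and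
      van: "\<And>P. P \<in> word_support c \<Longrightarrow>
        (\<Sum>a\<in>I. \<alpha> a * (fst P ^ fst (reduced_mon q a) * snd P ^ snd (reduced_mon q a))) = 0"
      using nontrivial_solution[OF fin finite less,
          of "\<lambda>a P. fst P ^ fst (reduced_mon q a) * snd P ^ snd (reduced_mon q a)"] by metis
    define A where "A = {a \<in> I. \<alpha> a \<noteq> 0}"
    define a0 where "a0 = Max A"
    have A: "finite A" "A \<noteq> {}" using fin \<alpha> by (auto simp: A_def)
    have a0: "a0 \<in> A" unfolding a0_def by (rule Max_in[OF A])
    have a0': "a0 \<in> weights q" "N - a0 \<in> weights q" "a0 \<le> N" using a0 by (auto simp: A_def I_def)
    obtain r s where rs: "reduced_mon q (N - a0) = (r, s)" by (cases "reduced_mon q (N - a0)")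
    then have w_rs: "wdeg q (r, s) = N - a0" using wdeg_reduced_mon[of q "N - a0"] a0' q by auto
    have w_red: "wdeg q (fst (reduced_mon q a), snd (reduced_mon q a)) = a" if "a \<in> I" for a
      using wdeg_reduced_mon[of q a] that q by (auto simp: I_def)
    define f where "f a = syndrome c (fst (reduced_mon q a) + r, snd (reduced_mon q a) + s)" for a
    have "0 = (\<Sum>P\<in>UNIV. c P * (fst P ^ r * snd P ^ s) *
        (\<Sum>a\<in>I. \<alpha> a * (fst P ^ fst (reduced_mon q a) * snd P ^ snd (reduced_mon q a))))"
      using van by (intro sum.neutral[symmetric]) (auto simp: word_support_def)
    also have "\<dots> = (\<Sum>a\<in>I. \<alpha> a * f a)"
      by (simp add: f_def syndrome_def sum_distrib_left sum.swap[of _ I] power_add mult_ac)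
    also have "\<dots> = \<alpha> a0 * f a0 + (\<Sum>a\<in>I - {a0}. \<alpha> a * f a)"
      using a0 by (intro sum.remove fin) (simp add: A_def)
    also have "(\<Sum>a\<in>I - {a0}. \<alpha> a * f a) = 0"
    proof (intro sum.neutral ballI)
      fix a assume a: "a \<in> I - {a0}"
      show "\<alpha> a * f a = 0"
      proof (cases "\<alpha> a = 0")
        case False
        then have "a \<le> a0" using a A unfolding a0_def by (intro Max_ge) (auto simp: A_def)
        then have "a < a0" using a by auto
        have "f a = 0" unfolding f_def
          by (rule low) (use \<open>a < a0\<close> a a0' w_rs w_red[of a] in \<open>simp add: wdeg_add del: wdeg_simp\<close>)
        then show ?thesis by simp
      qed simp
    qed
    finally have "\<alpha> a0 * f a0 = 0" by simp
    moreover have "f a0 \<noteq> 0" unfolding f_def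
      by (rule top) (use a0 a0' w_rs w_red[of a0] in \<open>simp add: wdeg_add A_def del: wdeg_simp\<close>)
    ultimately show False using a0 by (simp add: A_def)
  qed
  moreover have "N + 1 \<le> card I + q * (q - 1)"
  proof -
    let ?G = "- weights q"
    have gaps: "finite ?G" "2 * card ?G \<le> q * (q - 1)" using card_gaps q by auto
    have "{..N} \<subseteq> I \<union> ?G \<union> (\<lambda>a. N - a) ` ?G"
    proof
      fix a assume "a \<in> {..N}"
      then have "a = N - (N - a)" "a \<le> N" by simp_all
      then show "a \<in> I \<union> ?G \<union> (\<lambda>a. N - a) ` ?G"
        unfolding I_def by blast
    qed
    then have "card {..N} \<le> card (I \<union> ?G \<union> (\<lambda>a. N - a) ` ?G)"
      using gaps by (intro card_mono) (auto simp: I_def)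
    also have "\<dots> \<le> card I + card ?G + card ((\<lambda>a. N - a) ` ?G)"
      by (meson add_le_mono1 card_Un_le order_trans)
    also have "card ((\<lambda>a. N - a) ` ?G) \<le> card ?G"
      using gaps by (intro card_image_le)
    finally show ?thesis using gaps by simp
  qed
  ultimately show ?thesis using \<open>M \<le> N\<close> by (simp add: word_weight_def)
qed

section \<open>The Nullstellensatz over a finite field\<close>

lemma module_mult: "module ((*) :: 'b::comm_ring_1 \<Rightarrow> 'b \<Rightarrow> 'b)"
  by unfold_locales (simp_all add: algebra_simps)

lemma ideal_gen_base: "A \<in> S \<Longrightarrow> A \<in> ideal_gen S"
  and ideal_gen_add: "A \<in> ideal_gen S \<Longrightarrow> B \<in> ideal_gen S \<Longrightarrow> A + B \<in> ideal_gen S"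
  and ideal_gen_diff: "A \<in> ideal_gen S \<Longrightarrow> B \<in> ideal_gen S \<Longrightarrow> A - B \<in> ideal_gen S"
  and ideal_gen_mult_left: "A \<in> ideal_gen S \<Longrightarrow> C * A \<in> ideal_gen S"
  unfolding ideal_gen_def
  using module.span_base[OF module_mult] module.span_add[OF module_mult]
    module.span_diff[OF module_mult] module.span_scale[OF module_mult] by metis+

lemma ideal_gen_mult_right: "A \<in> ideal_gen S \<Longrightarrow> A * C \<in> ideal_gen S"
  using ideal_gen_mult_left[of A S C] by (simp add: mult.commute)

lemma ideal_gen_pairE:
  assumes "G \<in> ideal_gen {H, F}"
  obtains A B where "G = A * H + B * F"
proof -
  from assms obtain k where "G - k * H \<in> module.span (*) {F}"
    unfolding ideal_gen_def module.span_insert[OF module_mult, of H] by blast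
  then obtain l where "G - k * H = l * F"
    unfolding module.span_singleton[OF module_mult] by blast
  then show thesis by (intro that[of k l]) (simp add: algebra_simps)
qed

lemma const2_inverse: "a \<noteq> 0 \<Longrightarrow> [:[:inverse a:]:] * [:[:a:]:] = (1 :: 'a::field poly poly)"
  by (simp add: one_pCons)

lemma const2_cancel:
  assumes "[:[:a:]:] * G \<in> ideal_gen S" "a \<noteq> (0 :: 'a::field)"
  shows "G \<in> ideal_gen S"
proof -
  have "[:[:inverse a:]:] * ([:[:a:]:] * G) = ([:[:inverse a:]:] * [:[:a:]:]) * G"
    by (simp only: mult.assoc)
  also have "\<dots> = G" unfolding const2_inverse[OF assms(2)] by simp
  finally show ?thesis using ideal_gen_mult_left[OF assms(1)] by metis
qed

text \<open>
  \<open>t - b\<close> is invertible modulo \<open>t - c\<close> for \<open>c \<noteq> b\<close>: their difference is a nonzero constant. So the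
  factors \<open>t - c\<close> can be removed from \<open>G\<close> one after the other.
\<close>
lemma ideal_gen_coprime_factor:
  fixes t :: "'a::field poly poly"
  assumes "finite C" "b \<notin> C" "G * (t - [:[:b:]:]) \<in> ideal_gen S"
    and "G * (\<Prod>c\<in>C. t - [:[:c:]:]) \<in> ideal_gen S"
  shows "G \<in> ideal_gen S"
  using assms(1,2,4)
proof (induction C)
  case (insert c C)
  let ?\<Pi> = "\<Prod>c\<in>C. t - [:[:c:]:]"
  have "(G * (t - [:[:c:]:])) * ?\<Pi> \<in> ideal_gen S"
    using insert by (simp add: mult_ac)
  moreover have "(G * (t - [:[:b:]:])) * ?\<Pi> \<in> ideal_gen S"
    by (rule ideal_gen_mult_right[OF assms(3)])
  ultimately have "(G * (t - [:[:c:]:])) * ?\<Pi> - (G * (t - [:[:b:]:])) * ?\<Pi> \<in> ideal_gen S"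
    by (rule ideal_gen_diff)
  also have "(G * (t - [:[:c:]:])) * ?\<Pi> - (G * (t - [:[:b:]:])) * ?\<Pi> =
      ([:[:b:]:] - [:[:c:]:]) * (G * ?\<Pi>)"
    by (simp only: algebra_simps)
  also have "[:[:b:]:] - [:[:c:]:] = [:[:b - c:]:]" by simp
  finally have "G * ?\<Pi> \<in> ideal_gen S"
    by (rule const2_cancel) (use insert in auto)
  then show ?case using insert by simp
qed simp

text \<open>
  The products with one factor left out are jointly coprime, as in Lagrange interpolation; so \<open>G\<close> can
  be recovered from its multiples by them.
\<close>
lemma ideal_gen_cofactors:
  fixes t :: "'a::field poly poly"
  assumes "finite A" "A \<noteq> {}"
    and "\<And>a. a \<in> A \<Longrightarrow> G * (\<Prod>c\<in>A - {a}. t - [:[:c:]:]) \<in> ideal_gen S"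
  shows "G \<in> ideal_gen S"
  using assms
proof (induction A arbitrary: G rule: finite_ne_induct)
  case (insert b A)
  have "G * (t - [:[:b:]:]) \<in> ideal_gen S"
  proof (rule insert.IH)
    fix a assume a: "a \<in> A"
    then have "insert b A - {a} = insert b (A - {a})" using insert.hyps by auto
    then show "G * (t - [:[:b:]:]) * (\<Prod>c\<in>A - {a}. t - [:[:c:]:]) \<in> ideal_gen S"
      using insert.prems[of a] insert.hyps a by (simp add: mult.assoc)
  qed
  moreover have "G * (\<Prod>c\<in>A. t - [:[:c:]:]) \<in> ideal_gen S"
    using insert.prems[of b] insert.hyps by simp
  ultimately show ?case
    using insert.hyps ideal_gen_coprime_factor by metis
qed simp

text \<open>
  Both sides are monic of degree \<open>card Z\<close> and agree at the points of \<open>Z\<close>. The lemma is used for the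
  field itself, and for the field inside \<open>K[x]\<close>, which gives the equation for \<open>y\<close>.
\<close>
lemma prod_linear_factors:
  fixes Z :: "'r::idom set"
  assumes "card Z \<ge> 2" "\<And>z. z \<in> Z \<Longrightarrow> z ^ card Z = z"
  shows "(\<Prod>z\<in>Z. [:0, 1:] - [:z:]) = [:0, 1:] ^ card Z - [:0, 1:]"
proof -
  let ?n = "card Z"
  have [simp]: "[:0, 1:] ^ k = (monom 1 k :: 'r poly)" for k
    by (simp add: monom_altdef)
  have *: "[:0, 1:] - [:z:] = [:- z, 1:]" for z :: 'r by simp
  have fin: "finite Z" using assms(1) by (metis card.infinite not_numeral_le_zero)
  have deg: "degree (\<Prod>z\<in>Z. [:- z, 1:]) = ?n"
    by (subst degree_prod_sum_eq) auto
  have lc: "lead_coeff (\<Prod>z\<in>Z. [:- z, 1:]) = 1"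
    by (simp add: lead_coeff_prod)
  show ?thesis
    unfolding *
  proof (rule poly_eqI_degree_lead_coeff[where n = ?n and A = Z])
    show "coeff (\<Prod>z\<in>Z. [:- z, 1:]) ?n = coeff ([:0, 1:] ^ ?n - [:0, 1:]) ?n"
      using lc deg assms(1) by (simp add: coeff_eq_0)
    show "degree ([:0, 1:] ^ ?n - [:0, 1:] :: 'r poly) \<le> ?n"
      using assms(1) by (intro degree_diff_le) (auto simp: degree_monom_eq)
    show "poly (\<Prod>z\<in>Z. [:- z, 1:]) z = poly ([:0, 1:] ^ ?n - [:0, 1:]) z" if "z \<in> Z" for z
      using that fin assms by (auto simp: poly_prod poly_monom)
  qed (use deg in auto)
qed

lemma prod_var_x:
  "(\<Prod>a\<in>UNIV. var_x - [:[:a:]:]) = (var_x ^ card (UNIV :: 'a set) - var_x :: 'a::{field, finite} poly poly)"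
proof -
  have two: "card (UNIV :: 'a set) \<ge> 2"
    using card_mono[of "UNIV :: 'a set" "{0, 1}"] by simp
  have pw: "[:p:] ^ n = [:p ^ n:]" for p :: "'a poly" and n
    by (induction n) (simp_all add: one_pCons)
  have "(\<Prod>a\<in>A. var_x - [:[:a:]:]) = [:\<Prod>a\<in>A. [:0, 1:] - [:a:]:]" for A :: "'a set"
    by (induction A rule: infinite_finite_induct) (simp_all add: var_x_def one_pCons)
  then show ?thesis
    using prod_linear_factors[OF two finite_field_power_card] by (simp add: var_x_def pw)
qed

lemma prod_var_y:
  "(\<Prod>b\<in>UNIV. var_y - [:[:b:]:]) = (var_y ^ card (UNIV :: 'a set) - var_y :: 'a::{field, finite} poly poly)"
proof -
  let ?Z = "range (\<lambda>b::'a. [:b:])"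
  have card: "card ?Z = card (UNIV :: 'a set)"
    by (rule card_image) (simp add: inj_on_def)
  have two: "card ?Z \<ge> 2"
    unfolding card using card_mono[of "UNIV :: 'a set" "{0, 1}"] by simp
  have pw: "[:b:] ^ n = [:b ^ n:]" for b :: 'a and n
    by (induction n) (simp_all add: one_pCons)
  have "z ^ card ?Z = z" if "z \<in> ?Z" for z
    using that by (auto simp: card pw finite_field_power_card simp del: pCons_one)
  from prod_linear_factors[OF two this]
  have "(\<Prod>z\<in>?Z. [:0, 1:] - [:z:]) = [:0, 1:] ^ card (UNIV :: 'a set) - ([:0, 1:] :: 'a poly poly)"
    by (simp only: card)
  moreover have "(\<Prod>z\<in>?Z. [:0, 1:] - [:z:]) = (\<Prod>b\<in>UNIV. [:0, 1:] - [:[:b::'a:]:])"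
    by (subst prod.reindex) (auto simp: inj_on_def)
  ultimately show ?thesis by (simp only: var_y_def)
qed

text \<open>Division by \<open>y - b\<close>, then by \<open>x - a\<close>, leaves the value at the point \<open>(a, b)\<close>.\<close>
lemma point_remainder:
  obtains U V where "G - [:[:eval2 G (a, b):]:] =
    U * (var_x - [:[:a:]:]) + V * (var_y - [:[:b:]:])"
proof -
  have dvd: "[:- z, 1:] dvd p - [:poly p z:]" for p and z :: "'r::comm_ring_1"
    by (simp add: dvd_iff_poly_eq_0)
  obtain V where V: "G - [:poly G [:b:]:] = [:- [:b:], 1:] * V"
    using dvd[of "[:b:]" G] by (auto simp: dvd_def)
  obtain u where u: "poly G [:b:] - [:poly (poly G [:b:]) a:] = [:- a, 1:] * u"
    using dvd[of a "poly G [:b:]"] by (auto simp: dvd_def)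
  have "G - [:[:eval2 G (a, b):]:] = [:poly G [:b:] - [:poly (poly G [:b:]) a:]:] + (G - [:poly G [:b:]:])"
    by (simp add: eval2_def)
  also have "[:poly G [:b:] - [:poly (poly G [:b:]) a:]:] = [:u:] * (var_x - [:[:a:]:])"
    unfolding u by (simp add: var_x_def algebra_simps)
  also have "G - [:poly G [:b:]:] = V * (var_y - [:[:b:]:])"
    unfolding V by (simp add: var_y_def mult.commute)
  finally show thesis by (rule that)
qed

text \<open>
  Modulo the field equations, multiplication by \<open>x - a\<close> or by \<open>y - b\<close> kills the indicator polynomial
  of \<open>(a, b)\<close>, because it supplies the factor that is missing in \<open>x\<^sup>N - x\<close> or \<open>y\<^sup>N - y\<close>.
\<close>
lemma indicator_poly_eigen:
  fixes S :: "'a::{field, finite} poly poly set"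
  assumes "var_x ^ card (UNIV :: 'a set) - var_x \<in> ideal_gen S"
    and "var_y ^ card (UNIV :: 'a set) - var_y \<in> ideal_gen S"
  shows "G * indicator_poly P - [:[:eval2 G P:]:] * indicator_poly P \<in> ideal_gen S"
proof -
  obtain a b where P: "P = (a, b)" by (cases P)
  let ?X = "\<Prod>a'\<in>UNIV - {a}. var_x - [:[:a':]:]" and ?Y = "\<Prod>b'\<in>UNIV - {b}. var_y - [:[:b':]:]"
  obtain U V where UV: "G - [:[:eval2 G P:]:] = U * (var_x - [:[:a:]:]) + V * (var_y - [:[:b:]:])"
    unfolding P by (rule point_remainder)
  have "(var_x - [:[:a:]:]) * ?X = var_x ^ card (UNIV :: 'a set) - var_x"
    unfolding prod_var_x[symmetric] by (rule prod.remove[symmetric]) auto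
  then have X: "U * ?Y * ((var_x - [:[:a:]:]) * ?X) \<in> ideal_gen S"
    using assms(1) by (intro ideal_gen_mult_left[of _ _ "U * ?Y"]) simp
  have "(var_y - [:[:b:]:]) * ?Y = var_y ^ card (UNIV :: 'a set) - var_y"
    unfolding prod_var_y[symmetric] by (rule prod.remove[symmetric]) auto
  then have Y: "V * ?X * ((var_y - [:[:b:]:]) * ?Y) \<in> ideal_gen S"
    using assms(2) by (intro ideal_gen_mult_left[of _ _ "V * ?X"]) simp
  have "G * indicator_poly P - [:[:eval2 G P:]:] * indicator_poly P =
      (G - [:[:eval2 G P:]:]) * (?X * ?Y)"
    by (simp only: indicator_poly_def P fst_conv snd_conv left_diff_distrib)
  also have "\<dots> = U * ?Y * ((var_x - [:[:a:]:]) * ?X) + V * ?X * ((var_y - [:[:b:]:]) * ?Y)"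
    unfolding UV by (simp only: distrib_right distrib_left mult_ac)
  finally show ?thesis using ideal_gen_add[OF X Y] by simp
qed

text \<open>
  Let \<open>e\<close> be the indicator polynomial of a point \<open>P\<close>, and let \<open>G\<close> vanish on the zeros of \<open>S\<close>. If \<open>P\<close>
  is such a zero, then \<open>G e \<equiv> G(P) e = 0\<close>. Otherwise some \<open>A \<in> S\<close> has \<open>A(P) \<noteq> 0\<close>, so that \<open>e\<close> itself
  is congruent to a multiple of \<open>A e\<close>. Hence the ideal contains \<open>G e\<close> for each \<open>P\<close>, and the cofactor
  lemma, used for \<open>x\<close> and for \<open>y\<close>, recovers \<open>G\<close>.
\<close>
lemma finite_field_nullstellensatz:
  fixes S :: "'a::{field, finite} poly poly set"
  assumes "var_x ^ card (UNIV :: 'a set) - var_x \<in> ideal_gen S"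
    and "var_y ^ card (UNIV :: 'a set) - var_y \<in> ideal_gen S"
  shows "point_ideal {P. \<forall>A\<in>S. eval2 A P = 0} \<subseteq> ideal_gen S"
proof
  fix G assume G: "G \<in> point_ideal {P. \<forall>A\<in>S. eval2 A P = 0}"
  have ind: "G * indicator_poly P \<in> ideal_gen S" for P
  proof (cases "\<forall>A\<in>S. eval2 A P = 0")
    case True
    then have "eval2 G P = 0" using G unfolding point_ideal_def by blast
    then show ?thesis using indicator_poly_eigen[OF assms, of G P] by simp
  next
    case False
    then obtain A where A: "A \<in> S" "eval2 A P \<noteq> 0" by blast
    have "A * indicator_poly P \<in> ideal_gen S"
      by (intro ideal_gen_mult_right ideal_gen_base A)
    from ideal_gen_diff[OF this indicator_poly_eigen[OF assms, of A P]]
    have "[:[:eval2 A P:]:] * indicator_poly P \<in> ideal_gen S" by simp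
    then have "indicator_poly P \<in> ideal_gen S" using A(2) by (rule const2_cancel)
    then show ?thesis by (rule ideal_gen_mult_left)
  qed
  show "G \<in> ideal_gen S"
  proof (rule ideal_gen_cofactors[where t = var_x and A = UNIV])
    fix a :: 'a
    show "G * (\<Prod>c\<in>UNIV - {a}. var_x - [:[:c:]:]) \<in> ideal_gen S"
    proof (rule ideal_gen_cofactors[where t = var_y and A = UNIV])
      fix b :: 'a
      show "G * (\<Prod>c\<in>UNIV - {a}. var_x - [:[:c:]:]) * (\<Prod>c\<in>UNIV - {b}. var_y - [:[:c:]:]) \<in> ideal_gen S"
        using ind[of "(a, b)"] by (simp add: indicator_poly_def mult.assoc)
    qed auto
  qed auto
qed

section \<open>The order of a polynomial at infinity\<close>

definition subst_poly :: "('a::comm_ring_1 \<Rightarrow> 'b::comm_ring_1) \<Rightarrow> 'b \<Rightarrow> 'a poly \<Rightarrow> 'b" where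
  "subst_poly h z p = poly (map_poly h p) z"

lemma subst_poly_hom:
  fixes h :: "'a::comm_ring_1 \<Rightarrow> 'b::comm_ring_1"
  assumes "h 0 = 0" "\<And>a b. h (a + b) = h a + h b" "\<And>a b. h (a * b) = h a * h b"
  shows "subst_poly h z 0 = 0"
    and "subst_poly h z (p + r) = subst_poly h z p + subst_poly h z r"
    and "subst_poly h z (p * r) = subst_poly h z p * subst_poly h z r"
    and "subst_poly h z (monom a n) = h a * z ^ n"
proof -
  show "subst_poly h z 0 = 0" by (simp add: subst_poly_def)
  have add: "subst_poly h z (p + r) = subst_poly h z p + subst_poly h z r" for p r
  proof -
    have "map_poly h (p + r) = map_poly h p + map_poly h r"
      by (rule poly_eqI) (simp add: coeff_map_poly assms)
    then show ?thesis by (simp add: subst_poly_def)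
  qed
  then show "subst_poly h z (p + r) = subst_poly h z p + subst_poly h z r" .
  have hom_pCons: "subst_poly h z (pCons a p) = h a + z * subst_poly h z p" for a p
    by (simp add: subst_poly_def map_poly_pCons assms)
  have smult: "subst_poly h z (smult a p) = h a * subst_poly h z p" for a p
    by (simp add: subst_poly_def map_poly_smult assms)
  show "subst_poly h z (p * r) = subst_poly h z p * subst_poly h z r"
  proof (induction p)
    case 0
    then show ?case by (simp add: subst_poly_def)
  next
    case (pCons a p)
    then show ?case by (simp add: add hom_pCons smult assms(1) algebra_simps)
  qed
  show "subst_poly h z (monom a n) = h a * z ^ n"
    by (simp add: subst_poly_def map_poly_monom assms poly_monom)
qed

text \<open>
  The substitution \<open>x \<mapsto> t\<^sup>q\<close>, \<open>y \<mapsto> u t\<^sup>q\<^sup>+\<^sup>1\<close> into \<open>K[u][t]\<close>. The degree in \<open>t\<close> is the largest weight of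
  a monomial and the coefficient of \<open>t\<^sup>N\<close> is the form of weight \<open>N\<close>. The variable \<open>u\<close> records the
  exponent of \<open>y\<close>, which keeps monomials of the same weight apart.
\<close>
definition weight_poly :: "nat \<Rightarrow> 'a::comm_ring_1 poly poly \<Rightarrow> 'a poly poly" where
  "weight_poly q = subst_poly (subst_poly (\<lambda>c. [:[:c:]:]) (monom 1 q)) (monom [:0, 1:] (q + 1))"

lemma
  fixes F G :: "'a::comm_ring_1 poly poly" and c :: 'a
  shows weight_poly_0: "weight_poly q (0 :: 'a poly poly) = 0"
    and weight_poly_add: "weight_poly q (F + G) = weight_poly q F + weight_poly q G"
    and weight_poly_mult: "weight_poly q (F * G) = weight_poly q F * weight_poly q G"
    and weight_poly_monom: "weight_poly q (monom (monom c r) s) = monom (monom c s) (wdeg q (r, s))"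
proof -
  have h: "[:[:0:]:] = (0 :: 'a poly poly)" "[:[:a + b:]:] = [:[:a:]:] + [:[:b:]:]"
    "[:[:a * b:]:] = [:[:a:]:] * [:[:b:]:]" for a b :: 'a by simp_all
  note inner = subst_poly_hom[of "\<lambda>c. [:[:c:]:]", OF h, of "monom 1 q"]
  note outer = subst_poly_hom[of "subst_poly (\<lambda>c. [:[:c:]:]) (monom 1 q)", OF inner(1-3),
      of "monom [:0, 1:] (q + 1)", folded weight_poly_def]
  show "weight_poly q (0 :: 'a poly poly) = 0" "weight_poly q (F + G) = weight_poly q F + weight_poly q G"
    "weight_poly q (F * G) = weight_poly q F * weight_poly q G"
    by (fact outer)+
  have u: "[:0, 1:] ^ s = (monom 1 s :: 'a poly)" by (simp add: monom_altdef)
  have c: "[:[:c:]:] = (monom (monom c 0) 0 :: 'a poly poly)"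
    by (simp add: monom_0)
  show "weight_poly q (monom (monom c r) s) = monom (monom c s) (wdeg q (r, s))"
    unfolding outer(4) inner(4) by (simp add: c monom_power mult_monom u algebra_simps)
qed

lemma weight_poly_sum: "weight_poly q (\<Sum>i\<in>I. F i) = (\<Sum>i\<in>I. weight_poly q (F i))"
  by (induction I rule: infinite_finite_induct) (simp_all add: weight_poly_0 weight_poly_add)

lemma coeff_weight_poly:
  "coeff (weight_poly q F) N =
     (\<Sum>t\<in>exponents F. if wdeg q t = N then monom (coeff (coeff F (snd t)) (fst t)) (snd t) else 0)"
proof -
  have "weight_poly q F = (\<Sum>(r, s)\<in>exponents F. monom (monom (coeff (coeff F s) r) s) (wdeg q (r, s)))"
    using arg_cong[OF poly2_expansion[of F], of "weight_poly q"]
    by (simp only: weight_poly_sum case_prod_unfold weight_poly_monom)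
  then show ?thesis
    by (simp add: coeff_sum case_prod_unfold del: wdeg_simp)
qed

text \<open>
  The form of largest weight at \<open>x = y = 1\<close>. For \<open>H\<close> this form is \<open>x\<^sup>q\<^sup>+\<^sup>1 - y\<^sup>q\<close>, so the value is zero on
  all multiples of \<open>H\<close>, whereas it is nonzero on polynomials with a single heaviest monomial.
\<close>
definition leading_form_value :: "nat \<Rightarrow> 'a::comm_ring_1 poly poly \<Rightarrow> 'a" where
  "leading_form_value q F = poly (lead_coeff (weight_poly q F)) 1"

lemma leading_form_value_mult:
  fixes F G :: "'a::idom poly poly"
  shows "leading_form_value q (F * G) = leading_form_value q F * leading_form_value q G"
  by (simp add: leading_form_value_def weight_poly_mult lead_coeff_mult)

definition heaviest :: "nat \<Rightarrow> 'a::comm_ring_1 poly poly \<Rightarrow> nat \<times> nat \<Rightarrow> bool" where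
  "heaviest q F u \<longleftrightarrow> u \<in> exponents F \<and> (\<forall>v\<in>exponents F. v \<noteq> u \<longrightarrow> wdeg q v < wdeg q u)"

lemma
  assumes "heaviest q F u"
  shows degree_weight_poly: "degree (weight_poly q F) = wdeg q u"
    and leading_form_value_nonzero: "leading_form_value q F \<noteq> 0"
proof -
  obtain r s where u: "u = (r, s)" by (cases u)
  have le: "wdeg q v \<le> wdeg q u" if "v \<in> exponents F" for v
    using assms that by (cases "v = u") (auto simp: heaviest_def less_imp_le)
  have "coeff (weight_poly q F) (wdeg q u) =
    (\<Sum>t\<in>exponents F. if t = u then monom (coeff (coeff F s) r) s else 0)"
    unfolding coeff_weight_poly using assms
    by (intro sum.cong refl) (auto simp: heaviest_def u simp del: wdeg_simp)
  also have "\<dots> = monom (coeff (coeff F s) r) s"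
    using assms by (simp add: heaviest_def)
  finally have c: "coeff (weight_poly q F) (wdeg q u) = monom (coeff (coeff F s) r) s" .
  have nz: "coeff (coeff F s) r \<noteq> 0" using assms by (simp add: heaviest_def u exponents_def)
  show deg: "degree (weight_poly q F) = wdeg q u"
  proof (rule antisym)
    show "degree (weight_poly q F) \<le> wdeg q u"
    proof (rule degree_le, intro allI impI)
      fix N assume "wdeg q u < N"
      then show "coeff (weight_poly q F) N = 0"
        unfolding coeff_weight_poly using le by (intro sum.neutral) fastforce
    qed
    show "wdeg q u \<le> degree (weight_poly q F)"
      by (rule le_degree) (simp add: c nz del: wdeg_simp)
  qed
  show "leading_form_value q F \<noteq> 0"
    using nz by (simp add: leading_form_value_def deg c poly_monom del: wdeg_simp)
qed

text \<open>Distinct reduced monomials have distinct weights.\<close>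
lemma heaviest_reduced:
  fixes F :: "'a::comm_ring_1 poly poly"
  assumes "degree F < q" "F \<noteq> 0"
  shows "\<exists>u. heaviest q F u"
proof -
  obtain s where "coeff F s \<noteq> 0" using assms(2) by (metis leading_coeff_0_iff)
  then obtain r where "coeff (coeff F s) r \<noteq> 0" by (metis leading_coeff_0_iff)
  then have ne: "exponents F \<noteq> {}" by (auto simp: exponents_def)
  have small: "snd v < q" if "v \<in> exponents F" for v
  proof -
    have "coeff F (snd v) \<noteq> 0" using that by (auto simp: exponents_def)
    then show ?thesis using assms(1) le_degree[of F "snd v"] by simp
  qed
  have "Max (wdeg q ` exponents F) \<in> wdeg q ` exponents F"
    using ne by (intro Max_in) auto
  then obtain u where u: "u \<in> exponents F" "Max (wdeg q ` exponents F) = wdeg q u" by blast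
  have max: "wdeg q v \<le> wdeg q u" if "v \<in> exponents F" for v
    unfolding u(2)[symmetric] using that by (intro Max_ge) auto
  have "wdeg q v < wdeg q u" if v: "v \<in> exponents F" "v \<noteq> u" for v
  proof -
    have "wdeg q v \<noteq> wdeg q u"
      using reduced_mon_wdeg[OF small[OF v(1)], of "fst v"] reduced_mon_wdeg[OF small[OF u(1)], of "fst u"] v(2)
      by (auto simp del: wdeg_simp)
    with max[OF v(1)] show ?thesis by simp
  qed
  with u(1) show ?thesis unfolding heaviest_def by blast
qed

lemma var_x_power: "var_x ^ n = (monom (monom 1 n) 0 :: 'a::comm_ring_1 poly poly)"
proof -
  have *: "var_x = (monom (monom 1 1) 0 :: 'a poly poly)"
    by (simp add: var_x_def monom_0 monom_altdef)
  show ?thesis unfolding * by (simp add: monom_power)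
qed

lemma var_y_power: "var_y ^ n = (monom (monom 1 0) n :: 'a::comm_ring_1 poly poly)"
proof -
  have *: "var_y = (monom (monom 1 0) 1 :: 'a poly poly)"
    by (simp add: var_y_def monom_altdef)
  show ?thesis unfolding * by (simp add: monom_power)
qed

lemma leading_form_value_hermitian:
  assumes "q \<ge> 2"
  shows "leading_form_value q (hermitian_poly q :: 'a::idom poly poly) = 0"
proof -
  let ?Q = "monom (1 - monom 1 q) (q * (q + 1)) - monom (monom 1 1) (q + 1) :: 'a poly poly"
  have "weight_poly q (hermitian_poly q + var_y ^ q + var_y ^ 1) = weight_poly q (var_x ^ (q + 1) :: 'a poly poly)"
    by (simp add: hermitian_poly_def)
  then have W: "weight_poly q (hermitian_poly q) = ?Q"
    unfolding weight_poly_add var_x_power var_y_power weight_poly_monom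
    by (simp add: algebra_simps flip: add_monom diff_monom)
  have lt: "1 * (q + 1) < q * (q + 1)"
    using assms by (intro mult_strict_right_mono) auto
  have "q \<noteq> 1" using assms by simp
  then have c: "coeff ?Q (q * (q + 1)) = 1 - monom 1 q"
    using lt by simp
  have nz: "1 - monom 1 q \<noteq> (0 :: 'a poly)"
  proof
    assume "1 - monom 1 q = (0 :: 'a poly)"
    then have "coeff (1 - monom 1 q) 0 = (0 :: 'a)" by simp
    with assms show False by simp
  qed
  have "degree ?Q = q * (q + 1)"
  proof (rule antisym)
    show "degree ?Q \<le> q * (q + 1)"
      using lt by (intro degree_diff_le order_trans[OF degree_monom_le]) (use assms in auto)
    show "q * (q + 1) \<le> degree ?Q"
      by (rule le_degree) (simp only: c nz not_False_eq_True)
  qed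
  then show ?thesis
    by (simp only: leading_form_value_def W c) (simp add: poly_monom)
qed

text \<open>
  If the degrees of \<open>G\<close> and \<open>B F\<close> were different, then the leading form of the difference
  \<open>G - B F = A H\<close> would be that of \<open>G\<close> or that of \<open>- B F\<close>, and its value would not be zero.
\<close>
lemma weight_of_combination:
  fixes A B F G :: "'a::idom poly poly"
  assumes "q \<ge> 2" and eq: "G = A * hermitian_poly q + B * F"
    and G: "leading_form_value q G \<noteq> 0" and BF: "leading_form_value q B \<noteq> 0" "leading_form_value q F \<noteq> 0"
  shows "degree (weight_poly q G) = degree (weight_poly q B) + degree (weight_poly q F)"
proof -
  let ?W = "weight_poly q"
  have nz: "?W B \<noteq> 0" "?W F \<noteq> 0" using BF by (auto simp: leading_form_value_def)
  have BF': "poly (lead_coeff (?W (B * F))) 1 \<noteq> 0"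
    using BF leading_form_value_mult[of q B F] by (simp add: leading_form_value_def)
  have A: "poly (lead_coeff (?W (A * hermitian_poly q))) 1 = 0"
    using leading_form_value_mult[of q A "hermitian_poly q"] leading_form_value_hermitian[OF assms(1), where ?'a = 'a]
    unfolding leading_form_value_def[symmetric] by simp
  have W: "?W G = ?W (A * hermitian_poly q) + ?W (B * F)"
    by (simp add: eq weight_poly_add)
  have "degree (?W G) = degree (?W (B * F))"
  proof (rule ccontr)
    assume "\<not> ?thesis"
    then consider "degree (?W G) < degree (?W (B * F))" | "degree (?W (B * F)) < degree (?W G)" by linarith
    then show False
    proof cases
      case 1
      have eq: "?W (A * hermitian_poly q) = ?W G + - ?W (B * F)" by (simp add: W)
      have "lead_coeff (?W (A * hermitian_poly q)) = lead_coeff (- ?W (B * F))"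
        unfolding eq by (rule lead_coeff_add_le) (use 1 in simp)
      with A BF' show False by simp
    next
      case 2
      have eq: "?W (A * hermitian_poly q) = - ?W (B * F) + ?W G" by (simp add: W)
      have "lead_coeff (?W (A * hermitian_poly q)) = lead_coeff (?W G)"
        unfolding eq by (rule lead_coeff_add_le) (use 2 in simp)
      with A G show False by (simp add: leading_form_value_def)
    qed
  qed
  also have "\<dots> = degree (?W B) + degree (?W F)"
    unfolding weight_poly_mult using nz by (rule degree_mult_eq)
  finally show ?thesis .
qed

text \<open>Up to sign \<open>H\<close> is monic of degree \<open>q\<close> in \<open>y\<close>, the outer variable.\<close>
lemma hermitian_division:
  fixes B :: "'a::comm_ring_1 poly poly"
  assumes "q \<ge> 2"
  obtains A R where "B = A * hermitian_poly q + R" "degree R < q"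
proof -
  have "\<exists>A R. B = A * hermitian_poly q + R \<and> degree R < q"
  proof (induction B)
    case 0
    show ?case using assms by (intro exI[of _ 0]) auto
  next
    case (pCons a B)
    then obtain A R where AR: "B = A * hermitian_poly q + R" "degree R < q" by blast
    define c where "c = coeff (pCons a R) q"
    have coeffH: "coeff (hermitian_poly q :: 'a poly poly) n = (if n = q then - 1 else 0)" if "n \<ge> q" for n
    proof -
      have "hermitian_poly q = monom (monom 1 (q + 1)) 0 - monom (monom 1 0) q - (monom (monom 1 0) 1 :: 'a poly poly)"
        unfolding hermitian_poly_def var_x_power var_y_power[symmetric] by simp
      then show ?thesis using that assms by auto
    qed
    \<comment> \<open>\<open>H\<close> has the term \<open>- y\<^sup>q\<close>, so adding \<open>c H\<close> cancels the coefficient of \<open>y\<^sup>q\<close>.\<close>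
    let ?R = "pCons a R + [:c:] * hermitian_poly q"
    have "degree ?R < q"
    proof (rule degree_lessI)
      show "?R \<noteq> 0 \<or> q > 0" using assms by simp
      show "\<forall>k\<ge>q. coeff ?R k = 0"
      proof (intro allI impI)
        fix k assume k: "k \<ge> q"
        show "coeff ?R k = 0"
        proof (cases "k = q")
          case True
          then show ?thesis by (simp add: c_def coeffH)
        next
          case False
          with k have "degree (pCons a R) < k"
            using AR(2) degree_pCons_le[of a R] by linarith
          then have "coeff (pCons a R) k = 0" by (rule coeff_eq_0)
          with k False show ?thesis by (simp add: coeffH)
        qed
      qed
    qed
    moreover have "pCons a B = (pCons 0 A - [:c:]) * hermitian_poly q + ?R"
      by (simp add: AR(1) algebra_simps)
    ultimately show ?case by blast
  qed
  then show thesis using that by blast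
qed

section \<open>Zeros on the curve\<close>

lemma field_equations_vanish:
  fixes P :: "'a::{field, finite} \<times> 'a"
  assumes "card (UNIV :: 'a set) = N"
  shows "eval2 (var_x ^ N - var_x) P = 0" "eval2 (var_y ^ N - var_y) P = 0"
  unfolding eval2_simps assms[symmetric] finite_field_power_card by simp_all

text \<open>
  If \<open>D\<close> had fewer than \<open>d\<close> points, then some nonzero combination \<open>G\<close> of the \<open>d\<close> reduced monomials
  with weights in the Apery set would vanish on \<open>D\<close>, so \<open>G = A H + R F\<close>, with \<open>R\<close> reduced. The weight
  of \<open>G\<close> would be that of \<open>R\<close> plus \<open>d\<close>, which is not in the Apery set.
\<close>
lemma card_zeros_ge:
  fixes F :: "'a::{field, finite} poly poly"
  assumes q: "q \<ge> 2" and top: "heaviest q F u" and pos: "wdeg q u > 0"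
    and ideal: "point_ideal D \<subseteq> ideal_gen {hermitian_poly q, F}"
  shows "wdeg q u \<le> card D"
proof (rule ccontr)
  let ?d = "wdeg q u"
  assume neg: "\<not> ?thesis"
  have q0: "q > 0" using q by simp
  have fin: "finite (apery q ?d)" and card: "card (apery q ?d) = ?d"
    using finite_apery[OF q0 pos] card_apery[OF q0 pos] by simp_all
  have less: "card D < card (apery q ?d)" using neg card by linarith
  have finD: "finite D" by simp
  obtain \<alpha> where \<alpha>: "\<exists>a\<in>apery q ?d. \<alpha> a \<noteq> 0" "\<And>a. a \<notin> apery q ?d \<Longrightarrow> \<alpha> a = 0" and
    van: "\<And>P. P \<in> D \<Longrightarrow> (\<Sum>a\<in>apery q ?d. \<alpha> a * (fst P ^ fst (reduced_mon q a) * snd P ^ snd (reduced_mon q a))) = 0"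
    by (rule nontrivial_solution[OF fin finD less,
          of "\<lambda>a P. fst P ^ fst (reduced_mon q a) * snd P ^ snd (reduced_mon q a)"]) (rule that)
  define G where "G = (\<Sum>a\<in>apery q ?d. monom (monom (\<alpha> a) (fst (reduced_mon q a))) (snd (reduced_mon q a)))"
  have coeffG: "coeff (coeff G s) r = (\<Sum>a\<in>apery q ?d. if reduced_mon q a = (r, s) then \<alpha> a else 0)" for r s
    unfolding G_def coeff_sum by (intro sum.cong) (auto split: if_splits)
  have inj: "a = b" if "reduced_mon q a = reduced_mon q b" "a \<in> apery q ?d" "b \<in> apery q ?d" for a b
    using that wdeg_reduced_mon[OF q0] by (metis (no_types, lifting) apery_def mem_Collect_eq)
  obtain a0 where a0: "a0 \<in> apery q ?d" "\<alpha> a0 \<noteq> 0" using \<alpha>(1) by blast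
  have "coeff (coeff G (snd (reduced_mon q a0))) (fst (reduced_mon q a0)) = (\<Sum>a\<in>apery q ?d. if a = a0 then \<alpha> a else 0)"
    unfolding coeffG using inj a0 by (intro sum.cong) auto
  then have "G \<noteq> 0" using a0 fin by auto
  have expG: "\<exists>a\<in>apery q ?d. reduced_mon q a = v" if "v \<in> exponents G" for v
  proof (rule ccontr)
    assume "\<not> ?thesis"
    then have "coeff (coeff G (snd v)) (fst v) = 0"
      unfolding coeffG by (intro sum.neutral) auto
    with that show False by (auto simp: exponents_def)
  qed
  have "degree G < q"
  proof (rule degree_lessI)
    show "\<forall>k\<ge>q. coeff G k = 0"
    proof (intro allI impI poly_eqI)
      fix k r assume k: "q \<le> k"
      have "reduced_mon q a \<noteq> (r, k)" for a
        using mod_less_divisor[OF q0, of a] k by (auto simp: reduced_mon_def)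
      then show "coeff (coeff G k) r = coeff 0 r" unfolding coeffG by simp
    qed
  qed (use \<open>G \<noteq> 0\<close> in auto)
  then obtain v where v: "heaviest q G v" using heaviest_reduced \<open>G \<noteq> 0\<close> by blast
  then obtain a where a: "a \<in> apery q ?d" "reduced_mon q a = v" using expG[of v] unfolding heaviest_def by blast
  have wv: "wdeg q v = a" using a wdeg_reduced_mon[OF q0] by (auto simp: apery_def)
  have "eval2 G P = (\<Sum>a\<in>apery q ?d. \<alpha> a * (fst P ^ fst (reduced_mon q a) * snd P ^ snd (reduced_mon q a)))" for P
    by (simp add: G_def eval2_sum eval2_monom)
  then have "G \<in> point_ideal D" using van by (simp add: point_ideal_def)
  then have "G \<in> ideal_gen {hermitian_poly q, F}" using ideal by blast
  then obtain A B where AB: "G = A * hermitian_poly q + B * F" by (rule ideal_gen_pairE)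
  \<comment> \<open>The cofactor of \<open>F\<close> is reduced modulo \<open>H\<close> to give it a single heaviest monomial.\<close>
  obtain A' R where R: "B = A' * hermitian_poly q + R" "degree R < q"
    using hermitian_division[OF q] by blast
  have G: "G = (A + A' * F) * hermitian_poly q + R * F"
    unfolding AB R(1) by (simp add: algebra_simps)
  show False
  proof (cases "R = 0")
    case True
    then have "leading_form_value q G = 0"
      unfolding G using leading_form_value_mult[of q "A + A' * F" "hermitian_poly q"]
        leading_form_value_hermitian[OF q, where ?'a = 'a] by simp
    with leading_form_value_nonzero[OF v] show False by simp
  next
    case False
    then obtain w where w: "heaviest q R w" using heaviest_reduced R(2) by blast
    have "wdeg q v = wdeg q w + ?d"
      using weight_of_combination[OF q G leading_form_value_nonzero[OF v]
          leading_form_value_nonzero[OF w] leading_form_value_nonzero[OF top]]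
      by (simp only: degree_weight_poly[OF v] degree_weight_poly[OF w] degree_weight_poly[OF top])
    then have "a = ?d + wdeg q w" using wv by simp
    with a(1) show False by (auto simp: apery_def simp del: wdeg_simp)
  qed
qed

text \<open>
  A word supported on zeros of \<open>F\<close> has an array of syndromes that satisfies the recurrence given by
  the coefficients of \<open>F\<close>.
\<close>
lemma syndromes_vanish_from_apery:
  fixes c :: "'a::{field, finite} \<times> 'a \<Rightarrow> 'a"
  assumes q: "q \<ge> 2" and top: "heaviest q F u"
    and supp: "word_support c \<subseteq> hermitian_points q" "\<And>P. P \<in> word_support c \<Longrightarrow> eval2 F P = 0"
    and init: "\<And>a. a \<in> apery q (wdeg q u) \<Longrightarrow> a < M \<Longrightarrow> syndrome c (reduced_mon q a) = 0"
    and "wdeg q t < M"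
  shows "syndrome c t = 0"
  using q curve_array_syndrome[OF supp(1)] _ finite_exponents _ _ _ init assms(6)
proof (rule array_vanishes_from_apery)
  show "(\<Sum>(i, j)\<in>exponents F. coeff (coeff F (snd (i, j))) (fst (i, j)) * syndrome c (r + i, s + j)) = 0" for r s
  proof -
    have "c P * (fst P ^ r * snd P ^ s) * eval2 F P = 0" for P
      using supp(2)[of P] by (auto simp: word_support_def)
    then have "(\<Sum>P\<in>UNIV. c P * (fst P ^ r * snd P ^ s) * eval2 F P) = 0"
      by (intro sum.neutral) blast
    then show ?thesis using syndrome_relation[of F c r s] by simp
  qed
qed (use top in \<open>auto simp: heaviest_def exponents_def simp del: wdeg_simp\<close>)

lemma word_with_zero_syndromes:
  fixes D :: "('a::{field, finite} \<times> 'a) set"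
  assumes "finite T" "card T < card D"
  obtains c where "c \<noteq> (\<lambda>_. 0)" "word_support c \<subseteq> D" "\<And>t. t \<in> T \<Longrightarrow> syndrome c t = 0"
proof -
  have fin: "finite D" by simp
  obtain c where c: "\<exists>P\<in>D. c P \<noteq> 0" "\<And>P. P \<notin> D \<Longrightarrow> c P = 0" and
    zero: "\<And>t. t \<in> T \<Longrightarrow> (\<Sum>P\<in>D. c P * (fst P ^ fst t * snd P ^ snd t)) = 0"
    by (rule nontrivial_solution[OF fin assms, of "\<lambda>P t. fst P ^ fst t * snd P ^ snd t"]) (rule that)
  show thesis
  proof (rule that)
    show "c \<noteq> (\<lambda>_. 0)" using c(1) by auto
    show "word_support c \<subseteq> D" using c(2) by (auto simp: word_support_def)
    fix t assume "t \<in> T"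
    have "syndrome c t = (\<Sum>P\<in>D. c P * (fst P ^ fst t * snd P ^ snd t))"
      using c(2) unfolding syndrome_def split_beta by (intro sum.mono_neutral_right) auto
    with zero[OF \<open>t \<in> T\<close>] show "syndrome c t = 0" by simp
  qed
qed

text \<open>
  With more than \<open>d\<close> points there would be a nonzero word on \<open>D\<close> whose syndromes vanish on the Apery
  set, which has \<open>d\<close> elements; but then all its syndromes vanish.
\<close>
lemma card_zeros_le:
  fixes D :: "('a::{field, finite} \<times> 'a) set"
  assumes q: "q \<ge> 2" and top: "heaviest q F u" and pos: "wdeg q u > 0"
    and D: "D \<subseteq> hermitian_points q" "\<And>P. P \<in> D \<Longrightarrow> eval2 F P = 0"
  shows "card D \<le> wdeg q u"
proof (rule ccontr)
  let ?A = "apery q (wdeg q u)"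
  assume neg: "\<not> ?thesis"
  have q0: "q > 0" using q by simp
  have fin: "finite ?A" and card: "card ?A = wdeg q u"
    using finite_apery[OF q0 pos] card_apery[OF q0 pos] by simp_all
  have "card (reduced_mon q ` ?A) < card D"
    using card_image_le[OF fin, of "reduced_mon q"] neg card by linarith
  then obtain c where c: "c \<noteq> (\<lambda>_. 0)" "word_support c \<subseteq> D" "\<And>t. t \<in> reduced_mon q ` ?A \<Longrightarrow> syndrome c t = 0"
    using word_with_zero_syndromes[OF finite_imageI[OF fin]] by blast
  have "syndrome c t = 0" for t
  proof (rule syndromes_vanish_from_apery[OF q top _ _ _ lessI])
    show "word_support c \<subseteq> hermitian_points q" using c(2) D(1) by (rule order_trans)
    show "eval2 F P = 0" if "P \<in> word_support c" for P using D(2) c(2) that by blast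
    show "syndrome c (reduced_mon q a) = 0" if "a \<in> ?A" for a using c(3) that by blast
  qed
  then have "c P = 0" for P by (rule syndromes_determine_word)
  with c(1) show False by blast
qed

text \<open>
  The syndromes below weight \<open>M\<close> vanish as soon as those at weights of the Apery set below \<open>M\<close> do.
  There are at most \<open>d - 1\<close> of these, because the largest element of the Apery set is not below \<open>M\<close>.
\<close>
lemma word_on_zeros:
  fixes D :: "('a::{field, finite} \<times> 'a) set"
  assumes q: "q \<ge> 2" and top: "heaviest q F u" and pos: "wdeg q u > 0"
    and D: "D \<subseteq> hermitian_points q" "\<And>P. P \<in> D \<Longrightarrow> eval2 F P = 0"
    and many: "wdeg q u \<le> card D" and M: "M < wdeg q u + q * (q - 1)"
  obtains c where "c \<noteq> (\<lambda>_. 0)" "word_support c \<subseteq> D" "\<And>t. wdeg q t < M \<Longrightarrow> syndrome c t = 0"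
proof -
  let ?A = "apery q (wdeg q u)"
  have q0: "q > 0" using q by simp
  have fin: "finite ?A" and card: "card ?A = wdeg q u"
    using finite_apery[OF q0 pos] card_apery[OF q0 pos] by simp_all
  have finB: "finite (?A \<inter> {..<M})" by simp
  define e where "e = wdeg q u + (q * (q - 1) - 1)"
  have "e \<in> ?A" unfolding e_def by (rule largest_in_apery[OF q pos])
  moreover have "M \<le> e" using M unfolding e_def by linarith
  then have "e \<notin> {..<M}" by simp
  ultimately have "?A \<inter> {..<M} \<subset> ?A" by blast
  then have "card (?A \<inter> {..<M}) < wdeg q u"
    using psubset_card_mono[OF fin] card by metis
  then have "card (reduced_mon q ` (?A \<inter> {..<M})) < card D"
    using card_image_le[OF finB, of "reduced_mon q"] many by linarith
  then obtain c where c: "c \<noteq> (\<lambda>_. 0)" "word_support c \<subseteq> D"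
    "\<And>t. t \<in> reduced_mon q ` (?A \<inter> {..<M}) \<Longrightarrow> syndrome c t = 0"
    using word_with_zero_syndromes[OF finite_imageI[OF finB]] by blast
  have "syndrome c t = 0" if "wdeg q t < M" for t
  proof (rule syndromes_vanish_from_apery[OF q top _ _ _ that])
    show "word_support c \<subseteq> hermitian_points q" using c(2) D(1) by (rule order_trans)
    show "eval2 F P = 0" if "P \<in> word_support c" for P using D(2) c(2) that by blast
    show "syndrome c (reduced_mon q a) = 0" if "a \<in> ?A" "a < M" for a using c(3) that by blast
  qed
  then show thesis using c(1,2) that by blast
qed

text \<open>Translation by \<open>1\<close> preserves the sum of all elements.\<close>
lemma of_nat_card_eq_0: "of_nat (card (UNIV :: 'a::{ring_1, finite} set)) = (0 :: 'a)"
proof -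
  have "(\<Sum>x\<in>UNIV. x) = (\<Sum>x\<in>UNIV. x + 1 :: 'a)"
    by (rule sum.reindex_bij_witness[of _ "\<lambda>x. x + 1" "\<lambda>x. x - 1"]) auto
  also have "\<dots> = (\<Sum>x\<in>UNIV. x) + of_nat (card (UNIV :: 'a set))"
    by (simp add: sum.distrib)
  finally show ?thesis by simp
qed

text \<open>The characteristic divides \<open>q\<^sup>2\<close>, so it is the prime of which \<open>q\<close> is a power.\<close>
lemma frobenius_diff:
  fixes G1 G2 :: "'a::{field, finite} poly poly"
  assumes "primepow q" "card (UNIV :: 'a set) = q ^ 2"
  shows "(G1 - G2) ^ q = G1 ^ q - G2 ^ q"
proof -
  obtain p k where pk: "prime p" "q = p ^ k" using assms(1) by (auto simp: primepow_def)
  have char: "prime CHAR('a)"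
    by (intro prime_CHAR_semidom finite_imp_CHAR_pos) simp
  have "CHAR('a) dvd q ^ 2"
    using of_nat_card_eq_0[where ?'a = 'a] assms(2) by (metis of_nat_eq_0_iff_char_dvd)
  then have "CHAR('a) dvd p"
    using char pk(2) by (metis prime_dvd_power)
  then have "CHAR('a) = p" using char pk(1) by (simp add: primes_dvd_imp_eq)
  then have "CHAR('a poly poly) = p" by simp
  then have "((G1 - G2) + G2) ^ q = (G1 - G2) ^ q + G2 ^ q"
    using pk by (intro freshmans_dream'[where n = k]) auto
  then show ?thesis by (simp add: algebra_simps)
qed

text \<open>
  Raising \<open>y\<^sup>q = x\<^sup>q\<^sup>+\<^sup>1 - y - H\<close> to the power \<open>q\<close> and inserting the equation once more gives
  \<open>y\<^sup>Q - y = x\<^sup>q (x\<^sup>Q - x) + H - H\<^sup>q\<close> with \<open>Q = q\<^sup>2\<close>.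
\<close>
lemma y_field_equation_in_ideal:
  assumes "primepow q" "card (UNIV :: 'a::{field, finite} set) = q ^ 2"
  shows "var_y ^ (q ^ 2) - var_y \<in> ideal_gen {hermitian_poly q, var_x ^ (q ^ 2) - var_x :: 'a poly poly}"
    (is "_ \<in> ideal_gen {?H, ?X}")
proof -
  obtain n where n: "q = Suc n" using primepow_gt_Suc_0[OF assms(1)] by (cases q) auto
  have y: "var_y ^ q = var_x ^ (q + 1) - var_y - ?H"
    by (simp add: hermitian_poly_def)
  have "var_y ^ (q ^ 2) = (var_x ^ (q + 1) - var_y - ?H) ^ q"
    by (simp only: y[symmetric] power_mult[symmetric] power2_eq_square)
  also have "\<dots> = (var_x ^ (q + 1)) ^ q - var_y ^ q - ?H ^ q"
    by (simp only: frobenius_diff[OF assms])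
  also have "(var_x ^ (q + 1)) ^ q = var_x ^ q * var_x ^ (q ^ 2)"
    by (simp only: power_mult[symmetric] power_add[symmetric]) (simp add: power2_eq_square algebra_simps)
  finally have "var_y ^ (q ^ 2) - var_y = var_x ^ q * ?X + (?H - ?H ^ q)"
    unfolding y by (simp add: algebra_simps)
  also have "\<dots> \<in> ideal_gen {?H, ?X}"
  proof (rule ideal_gen_add)
    show "var_x ^ q * ?X \<in> ideal_gen {?H, ?X}"
      by (intro ideal_gen_mult_left ideal_gen_base) simp
    have "?H \<in> ideal_gen {?H, ?X}" by (rule ideal_gen_base) simp
    then show "?H - ?H ^ q \<in> ideal_gen {?H, ?X}"
      unfolding n by (intro ideal_gen_diff) (simp_all add: ideal_gen_mult_right)
  qed
  finally show ?thesis .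
qed

lemma heaviest_field_equation:
  assumes "q \<ge> 2"
  shows "heaviest q (var_x ^ (q ^ 2) - var_x :: 'a::comm_ring_1 poly poly) (q ^ 2, 0)"
proof -
  define N where "N = q ^ 2"
  have N: "1 < N" unfolding N_def using assms by (intro one_less_power) auto
  have x: "var_x = (monom (monom 1 1) 0 :: 'a poly poly)"
    using var_x_power[of 1] by (simp only: power_one_right)
  have "var_x ^ N - var_x = (monom (monom 1 N - monom 1 1) 0 :: 'a poly poly)"
    unfolding x by (simp add: monom_power diff_monom)
  then have "coeff (coeff (var_x ^ N - var_x :: 'a poly poly) s) r =
      (if s = 0 then (if r = N then 1 else 0) - (if r = 1 then 1 else 0) else 0)" for r s
    by simp
  then have "exponents (var_x ^ N - var_x :: 'a poly poly) = {(N, 0), (1, 0)}"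
    unfolding exponents_def using N by (auto split: if_splits)
  then show ?thesis
    unfolding heaviest_def N_def[symmetric] using N assms by simp
qed

text \<open>
  The zeros on the curve of the field equation for \<open>x\<close>, which has weight \<open>q\<^sup>3\<close>, are all its rational
  points.
\<close>
lemma card_hermitian_points_ge:
  assumes "primepow q" "card (UNIV :: 'a::{field, finite} set) = q ^ 2"
  shows "q ^ 3 \<le> card (hermitian_points q :: ('a \<times> 'a) set)"
proof -
  have q: "q \<ge> 2" using primepow_gt_Suc_0[OF assms(1)] by simp
  let ?S = "{hermitian_poly q, var_x ^ (q ^ 2) - var_x :: 'a poly poly}"
  have "{P. \<forall>A\<in>?S. eval2 A P = 0} = hermitian_points q"
    using field_equations_vanish(1)[OF assms(2)] by (auto simp: hermitian_points_def)
  moreover have "point_ideal {P. \<forall>A\<in>?S. eval2 A P = 0} \<subseteq> ideal_gen ?S"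
    using y_field_equation_in_ideal[OF assms] by (intro finite_field_nullstellensatz) (simp_all add: assms(2) ideal_gen_base)
  ultimately have "wdeg q (q ^ 2, 0) \<le> card (hermitian_points q :: ('a \<times> 'a) set)"
    using card_zeros_ge[OF q heaviest_field_equation[OF q]] q by simp
  then show ?thesis by (simp add: power2_eq_square power3_eq_cube)
qed

text \<open>
  A monomial of smaller total degree weighs at most \<open>(\<mu> + l - 1)(q + 1)\<close>, which is less than
  \<open>(\<mu> + l)q + l\<close> for \<open>\<mu> \<le> q\<close>. For equal total degree, DegRevLex and the weight both prefer the larger
  exponent of \<open>y\<close>.
\<close>
lemma lead_mon_heaviest:
  fixes F :: "'a::comm_ring_1 poly poly"
  assumes "F \<noteq> 0" "lead_mon F = (\<mu>, l)" "\<mu> \<le> q"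
  shows "heaviest q F (\<mu>, l)"
proof -
  have trans: "drl_less a c" if "drl_less a b" "drl_less b c" for a b c
    using that by (auto simp: drl_less_def split: prod.splits)
  have total: "drl_less a b \<or> drl_less b a" if "a \<noteq> b" for a b
    using that by (auto simp: drl_less_def split: prod.splits)
  have irrefl: "\<not> drl_less a a" for a by (auto simp: drl_less_def)
  define L where "L t \<longleftrightarrow> t \<in> exponents F \<and> (\<forall>u\<in>exponents F. u \<noteq> t \<longrightarrow> drl_less u t)" for t
  have ex: "\<exists>t\<in>T. \<forall>u\<in>T. u \<noteq> t \<longrightarrow> drl_less u t" if "finite T" "T \<noteq> {}" for T
    using that
  proof (induction T rule: finite_ne_induct)
    case (insert a T)
    then obtain t where t: "t \<in> T" "\<forall>u\<in>T. u \<noteq> t \<longrightarrow> drl_less u t" by blast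
    then show ?case
      using total[of a t] trans insert.hyps by (metis insert_iff)
  qed simp
  obtain s where "coeff F s \<noteq> 0" using assms(1) by (metis leading_coeff_0_iff)
  then obtain r where "coeff (coeff F s) r \<noteq> 0" by (metis leading_coeff_0_iff)
  then have "exponents F \<noteq> {}" by (auto simp: exponents_def)
  then obtain t where t: "L t" using ex[of "exponents F"] by (auto simp: L_def)
  have uniq: "v = t" if "L v" for v
  proof (rule ccontr)
    assume "v \<noteq> t"
    then have "drl_less v t" "drl_less t v" using that t by (auto simp: L_def)
    with trans irrefl show False by blast
  qed
  have "lead_mon F = t"
    unfolding lead_mon_def L_def[symmetric] using t uniq by (rule the_equality)
  with t assms(2) have L: "L (\<mu>, l)" by simp
  have "wdeg q (r, s) < wdeg q (\<mu>, l)" if "drl_less (r, s) (\<mu>, l)" for r s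
  proof (cases "r + s < \<mu> + l")
    case True
    then have "(r + s + 1) * (q + 1) \<le> (\<mu> + l) * (q + 1)" by (intro mult_right_mono) auto
    then show ?thesis using assms(3) by (simp add: algebra_simps)
  next
    case False
    then have "r + s = \<mu> + l" "s < l" using that by (auto simp: drl_less_def)
    then have "(r + s) * q + s < (\<mu> + l) * q + l" by simp
    then show ?thesis by (simp add: algebra_simps)
  qed
  with L show ?thesis unfolding heaviest_def L_def by (metis surj_pair)
qed

section \<open>Minimum-weight codewords\<close>

text \<open>
  The count of conditions with the field equation for \<open>x\<close> in place of \<open>F\<close>: its zeros are all points of
  the curve, \<open>d = q\<^sup>3\<close>, and the upper bound on \<open>m\<close> says that \<open>m\<close> is below \<open>d + q(q - 1) - 1\<close>, the
  largest element of the Apery set.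
\<close>
lemma hermitian_code_nontrivial:
  assumes "primepow q" "card (UNIV :: 'a::{field, finite} set) = q ^ 2"
    and "m \<le> int q ^ 3 + int q ^ 2 - int q - 2" "0 \<le> m"
  obtains c :: "'a::{field, finite} \<times> 'a \<Rightarrow> 'a" where "c \<in> hermitian_code q m" "c \<noteq> (\<lambda>_. 0)"
proof -
  have q: "q \<ge> 2" using primepow_gt_Suc_0[OF assms(1)] by simp
  let ?X = "var_x ^ (q ^ 2) - var_x :: 'a poly poly"
  have w: "wdeg q (q ^ 2, 0) = q ^ 3" by (simp add: power2_eq_square power3_eq_cube)
  have "int (q ^ 3 + q * (q - 1)) = int q ^ 3 + int q ^ 2 - int q"
    using q by (cases q) (simp_all add: power2_eq_square power3_eq_cube algebra_simps)
  then have M: "nat (m + 1) < q ^ 3 + q * (q - 1)"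
    using assms(3,4) by linarith
  obtain c :: "'a \<times> 'a \<Rightarrow> 'a" where c: "c \<noteq> (\<lambda>_. 0)" "word_support c \<subseteq> hermitian_points q"
    "\<And>t. wdeg q t < nat (m + 1) \<Longrightarrow> syndrome c t = 0"
  proof (rule word_on_zeros[OF q heaviest_field_equation[OF q]])
    show "eval2 ?X P = 0" for P by (rule field_equations_vanish(1)[OF assms(2)])
  qed (use q M card_hermitian_points_ge[OF assms(1,2)] in \<open>simp_all only: w, simp_all\<close>)
  have "c \<in> hermitian_code q m"
    unfolding mem_hermitian_code using c(2,3) by (auto simp: basis_monomials_upto_def simp del: wdeg_simp)
  with c(1) show thesis using that by blast
qed

lemma code_distance_le:
  fixes C :: "('a::{comm_ring_1, finite} \<times> 'a \<Rightarrow> 'a) set"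
  assumes "c \<in> C" "c \<noteq> (\<lambda>_. 0)"
  shows "code_distance C \<le> word_weight c"
  unfolding code_distance_def using assms by (intro Min_le) auto

text \<open>
  There is a nonzero codeword, so the minimum that defines the distance is attained, and the Feng-Rao
  bound applies to a word of that weight.
\<close>
lemma goppa_bound:
  assumes "primepow q" "card (UNIV :: 'a::{field, finite} set) = q ^ 2"
    and "m \<le> int q ^ 3 + int q ^ 2 - int q - 2" "0 \<le> m"
  shows "m + 2 \<le> int (code_distance (hermitian_code q m :: ('a \<times> 'a \<Rightarrow> 'a) set)) + int (q * (q - 1))"
proof -
  let ?C = "hermitian_code q m :: ('a \<times> 'a \<Rightarrow> 'a) set"
  have q: "q \<ge> 2" using primepow_gt_Suc_0[OF assms(1)] by simp
  have "{c \<in> ?C. c \<noteq> (\<lambda>_. 0)} \<noteq> {}"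
    using hermitian_code_nontrivial[OF assms] by blast
  then have "code_distance ?C \<in> word_weight ` {c \<in> ?C. c \<noteq> (\<lambda>_. 0)}"
    unfolding code_distance_def by (intro Min_in) auto
  then obtain c where c: "c \<in> ?C" "c \<noteq> (\<lambda>_. 0)" "code_distance ?C = word_weight c" by auto
  have "syndrome c t = 0" if "wdeg q t < nat (m + 1)" for t
    by (rule hermitian_code_syndromes[OF q assms(2) c(1)]) (use that in linarith)
  then have "nat (m + 1) + 1 \<le> word_weight c + q * (q - 1)"
    using c(1,2) by (intro feng_rao_bound[OF q]) (simp_all add: mem_hermitian_code)
  then show ?thesis using c(3) assms(4) by linarith
qed

theorem corollary5p3:
  fixes q \<mu> l :: nat and m :: int and F :: "'a::{field, finite} poly poly"
  assumes "primepow q"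
    and "card (UNIV :: 'a set) = q ^ 2"
    and "2 * int q ^ 2 - 2 * int q - 2 \<le> m"
    and "m \<le> int q ^ 3 + int q ^ 2 - int q - 2"
    and "admissible_label q m"
    and "code_distance (hermitian_code q m :: ('a \<times> 'a \<Rightarrow> 'a) set) = \<mu> * q + l * (q + 1)"
    and "\<mu> \<le> q"
    and "F \<noteq> 0"
    and "lead_mon F = (\<mu>, l)"
  shows "(\<exists>D. cuts_on_hermitian q F D \<and> rational_divisor q D \<and>
            (\<exists>c. min_weight_codeword (hermitian_code q m) c \<and> word_support c = D))
         \<longleftrightarrow>
         var_x ^ (q ^ 2) - var_x \<in> ideal_gen {hermitian_poly q, F} \<and>
         var_y ^ (q ^ 2) - var_y \<in> ideal_gen {hermitian_poly q, F}"
proof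
  assume "\<exists>D. cuts_on_hermitian q F D \<and> rational_divisor q D \<and>
            (\<exists>c. min_weight_codeword (hermitian_code q m) c \<and> word_support c = D)"
  then obtain D where "point_ideal D = ideal_gen {hermitian_poly q, F}"
    by (auto simp: cuts_on_hermitian_def)
  then show "var_x ^ (q ^ 2) - var_x \<in> ideal_gen {hermitian_poly q, F} \<and>
         var_y ^ (q ^ 2) - var_y \<in> ideal_gen {hermitian_poly q, F}"
    using field_equations_vanish[OF assms(2)] by (auto simp: point_ideal_def)
next
  let ?J = "ideal_gen {hermitian_poly q, F}"
  let ?C = "hermitian_code q m :: ('a \<times> 'a \<Rightarrow> 'a) set"
  assume fields: "var_x ^ (q ^ 2) - var_x \<in> ?J \<and> var_y ^ (q ^ 2) - var_y \<in> ?J"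
  define D where "D = {P. \<forall>A\<in>{hermitian_poly q, F}. eval2 A P = 0}"
  have D: "D \<subseteq> hermitian_points q" "\<And>P. P \<in> D \<Longrightarrow> eval2 F P = 0"
    by (auto simp: D_def hermitian_points_def)
  have sub: "point_ideal D \<subseteq> ?J"
    unfolding D_def using fields by (intro finite_field_nullstellensatz) (simp_all add: assms(2))
  moreover have "?J \<subseteq> point_ideal D"
  proof
    fix G assume "G \<in> ?J"
    then obtain A B where "G = A * hermitian_poly q + B * F" by (rule ideal_gen_pairE)
    then show "G \<in> point_ideal D" by (simp add: point_ideal_def D_def eval2_simps)
  qed
  ultimately have cuts: "cuts_on_hermitian q F D" by (simp add: cuts_on_hermitian_def)
  have q: "q \<ge> 2" using primepow_gt_Suc_0[OF assms(1)] by simp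
  have top: "heaviest q F (\<mu>, l)" by (rule lead_mon_heaviest) (use assms in auto)
  let ?d = "wdeg q (\<mu>, l)"
  have d: "code_distance ?C = ?d" using assms(6) by simp
  \<comment> \<open>The lower bound on \<open>m\<close> makes the Goppa bound positive.\<close>
  have big: "2 * q * (q - 1) \<le> nat (m + 2)" "0 \<le> m"
  proof -
    have qq: "int q * (int q - 1) \<ge> 2 * 1" using q by (intro mult_mono) auto
    have "2 * int q * (int q - 1) \<le> m + 2"
      using assms(3) by (simp add: power2_eq_square algebra_simps)
    moreover have "int (2 * q * (q - 1)) = 2 * int q * (int q - 1)" using q by (simp add: of_nat_diff)
    ultimately show "2 * q * (q - 1) \<le> nat (m + 2)" "0 \<le> m" using qq by linarith+
  qed
  have goppa: "nat (m + 2) \<le> ?d + q * (q - 1)"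
    using goppa_bound[OF assms(1,2,4) big(2)] unfolding d by linarith
  have "q * (q - 1) > 0" using q by simp
  then have pos: "?d > 0" using goppa big(1) by linarith
  have card_D: "card D = ?d"
    using card_zeros_ge[OF q top pos sub] card_zeros_le[OF q top pos D] by (rule order_antisym[rotated])
  have "nat (m + 1) < ?d + q * (q - 1)" using goppa big(2) by linarith
  then obtain c where c: "c \<noteq> (\<lambda>_. 0)" "word_support c \<subseteq> D"
    "\<And>t. wdeg q t < nat (m + 1) \<Longrightarrow> syndrome c t = 0"
    using word_on_zeros[OF q top pos D] card_D by (metis order_refl)
  have "c \<in> ?C"
    unfolding mem_hermitian_code using c(2,3) D(1) by (auto simp: basis_monomials_upto_def simp del: wdeg_simp)
  then have "card D \<le> card (word_support c)"
    using code_distance_le[of c ?C] c(1) d card_D by (simp add: word_weight_def)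
  then have supp: "word_support c = D"
    by (intro card_seteq c(2)) simp_all
  then have "min_weight_codeword ?C c"
    using \<open>c \<in> ?C\<close> d card_D by (simp add: min_weight_codeword_def word_weight_def)
  then show "\<exists>D. cuts_on_hermitian q F D \<and> rational_divisor q D \<and>
            (\<exists>c. min_weight_codeword (hermitian_code q m) c \<and> word_support c = D)"
    using cuts D(1) supp by (auto simp: rational_divisor_def)
qed

end
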